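(* There is an algorithm that solves the Both $k$-near Chain Editing problem in time $O(n^3 k^{4k+4})$, where $n=|S|+|Q|$.
   Context: The input is a bipartite graph $G=(S\cup Q,E)$ (students $S$, questions $Q$; $sq\in E$ means student $s$ answered question $q$ correctly), bijections $\alpha:S\to\{1,\dots,|S|\}$ and $\gamma:Q\to\{1,\dots,|Q|\}$ (initial student and question orderings) and a positive integer $k$. For a vertex $x$, $N(x)$ denotes its neighborhood. An ordering (bijection) $\pi:S\to\{1,\dots,|S|\}$ is nested if $\pi(s_1)\ge \pi(s_2)$ implies $N(s_1)\supseteq N(s_2)$. An ordering $\beta:Q\to\{1,\dots,|Q|\}$ satisfies the interval property if for every $s\in S$, $N(s)=\{\beta^{-1}(1),\dots,\beta^{-1}(j)\}$ for some $j\in\{0,\dots,|Q|\}$. An edge edit is the addition or deletion of a student–question pair. The Both $k$-near Chain Editing problem asks for a minimum-size set of edge edits such that in the edited graph there is a nested student ordering $\pi$ with $\pi(s)\in[\alpha(s)-k,\alpha(s)+k]$ for all $s\in S$ and a question ordering $\beta$ satisfying the interval property with $\beta(q)\in[\gamma(q)-k,\gamma(q)+k]$ for all $q\in Q$. *)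

theory Defs
  imports Main
begin

section \<open>Both k-near chain editing\<close>

text \<open>
  A bipartite graph with students \<open>S\<close> and questions \<open>Q\<close> is given by its edge set
  \<open>E \<subseteq> S \<times> Q\<close>; the neighbourhood of a student \<open>s\<close> is \<open>E `` {s}\<close>.
\<close>

definition ordering_of :: "'a set \<Rightarrow> ('a \<Rightarrow> nat) \<Rightarrow> bool" where
  "ordering_of V f \<longleftrightarrow> bij_betw f V {1..card V}"

definition nested :: "'s set \<Rightarrow> ('s \<times> 'q) set \<Rightarrow> ('s \<Rightarrow> nat) \<Rightarrow> bool" where
  "nested S E \<pi> \<longleftrightarrow> (\<forall>s1\<in>S. \<forall>s2\<in>S. \<pi> s1 \<ge> \<pi> s2 \<longrightarrow> E `` {s1} \<supseteq> E `` {s2})"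

definition interval_property :: "'s set \<Rightarrow> 'q set \<Rightarrow> ('s \<times> 'q) set \<Rightarrow> ('q \<Rightarrow> nat) \<Rightarrow> bool" where
  "interval_property S Q E \<beta> \<longleftrightarrow>
     (\<forall>s\<in>S. \<exists>j\<in>{0..card Q}. E `` {s} = inv_into Q \<beta> ` {1..j})"

definition near :: "nat \<Rightarrow> 'a set \<Rightarrow> ('a \<Rightarrow> nat) \<Rightarrow> ('a \<Rightarrow> nat) \<Rightarrow> bool" where
  "near k V f g \<longleftrightarrow> (\<forall>v\<in>V. int (g v) \<in> {int (f v) - int k .. int (f v) + int k})"

text \<open>Editing the pairs in \<open>F\<close> deletes those that are edges and adds those that are not.\<close>

definition edit :: "('s \<times> 'q) set \<Rightarrow> ('s \<times> 'q) set \<Rightarrow> ('s \<times> 'q) set" where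
  "edit E F = (E - F) \<union> (F - E)"

definition both_near_instance ::
  "'s set \<Rightarrow> 'q set \<Rightarrow> ('s \<times> 'q) set \<Rightarrow> ('s \<Rightarrow> nat) \<Rightarrow> ('q \<Rightarrow> nat) \<Rightarrow> nat \<Rightarrow> bool" where
  "both_near_instance S Q E \<alpha> \<gamma> k \<longleftrightarrow>
     finite S \<and> finite Q \<and> E \<subseteq> S \<times> Q \<and> ordering_of S \<alpha> \<and> ordering_of Q \<gamma> \<and> k > 0"

definition both_near_feasible ::
  "'s set \<Rightarrow> 'q set \<Rightarrow> ('s \<times> 'q) set \<Rightarrow> ('s \<Rightarrow> nat) \<Rightarrow> ('q \<Rightarrow> nat) \<Rightarrow> nat
     \<Rightarrow> ('s \<times> 'q) set \<Rightarrow> bool" where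
  "both_near_feasible S Q E \<alpha> \<gamma> k F \<longleftrightarrow>
     F \<subseteq> S \<times> Q \<and>
     (\<exists>\<pi>. ordering_of S \<pi> \<and> nested S (edit E F) \<pi> \<and> near k S \<alpha> \<pi>) \<and>
     (\<exists>\<beta>. ordering_of Q \<beta> \<and> interval_property S Q (edit E F) \<beta> \<and> near k Q \<gamma> \<beta>)"

definition both_near_solution ::
  "'s set \<Rightarrow> 'q set \<Rightarrow> ('s \<times> 'q) set \<Rightarrow> ('s \<Rightarrow> nat) \<Rightarrow> ('q \<Rightarrow> nat) \<Rightarrow> nat
     \<Rightarrow> ('s \<times> 'q) set \<Rightarrow> bool" where
  "both_near_solution S Q E \<alpha> \<gamma> k F \<longleftrightarrow>
     both_near_feasible S Q E \<alpha> \<gamma> k F \<and>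
     (\<forall>F'. both_near_feasible S Q E \<alpha> \<gamma> k F' \<longrightarrow> card F \<le> card F')"


section \<open>Algorithms and running time\<close>

text \<open>
  Algorithms are while programs on a random access machine with the uniform cost measure.
  A program uses finitely many registers and finitely many unbounded one-dimensional arrays of
  natural numbers. The only arithmetic is addition and truncated subtraction: with
  unit-cost multiplication on unbounded numbers, step counts would no longer be a reasonable
  measure of time. Every operator, operand, array access, test and assignment that is executed
  costs one unit.
\<close>

record store =
  reg :: "nat \<Rightarrow> nat"
  arr :: "nat \<Rightarrow> nat \<Rightarrow> nat"

datatype aexp =
    Const nat
  | Reg nat
  | Arr nat aexp
  | Plus aexp aexp
  | Minus aexp aexp

datatype bexp =
    Less aexp aexp
  | Equal aexp aexp
  | Neg bexp
  | Conj bexp bexp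

datatype com =
    Skip
  | Assign nat aexp
  | Store nat aexp aexp
  | Seq com com
  | IfElse bexp com com
  | While bexp com

fun aval :: "aexp \<Rightarrow> store \<Rightarrow> nat" where
  "aval (Const n) \<sigma> = n"
| "aval (Reg x) \<sigma> = reg \<sigma> x"
| "aval (Arr A a) \<sigma> = arr \<sigma> A (aval a \<sigma>)"
| "aval (Plus a b) \<sigma> = aval a \<sigma> + aval b \<sigma>"
| "aval (Minus a b) \<sigma> = aval a \<sigma> - aval b \<sigma>"

fun acost :: "aexp \<Rightarrow> nat" where
  "acost (Const n) = 1"
| "acost (Reg x) = 1"
| "acost (Arr A a) = 1 + acost a"
| "acost (Plus a b) = 1 + acost a + acost b"
| "acost (Minus a b) = 1 + acost a + acost b"

fun bval :: "bexp \<Rightarrow> store \<Rightarrow> bool" where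
  "bval (Less a b) \<sigma> \<longleftrightarrow> aval a \<sigma> < aval b \<sigma>"
| "bval (Equal a b) \<sigma> \<longleftrightarrow> aval a \<sigma> = aval b \<sigma>"
| "bval (Neg b) \<sigma> \<longleftrightarrow> \<not> bval b \<sigma>"
| "bval (Conj b c) \<sigma> \<longleftrightarrow> bval b \<sigma> \<and> bval c \<sigma>"

fun bcost :: "bexp \<Rightarrow> nat" where
  "bcost (Less a b) = 1 + acost a + acost b"
| "bcost (Equal a b) = 1 + acost a + acost b"
| "bcost (Neg b) = 1 + bcost b"
| "bcost (Conj b c) = 1 + bcost b + bcost c"

text \<open>\<open>exec c \<sigma> t \<sigma>'\<close>: started in \<open>\<sigma>\<close>, the program \<open>c\<close> halts in \<open>\<sigma>'\<close> after \<open>t\<close> time units.\<close>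

inductive exec :: "com \<Rightarrow> store \<Rightarrow> nat \<Rightarrow> store \<Rightarrow> bool" where
  Skip: "exec Skip \<sigma> 1 \<sigma>"
| Assign: "exec (Assign x a) \<sigma> (1 + acost a) (\<sigma>\<lparr>reg := (reg \<sigma>)(x := aval a \<sigma>)\<rparr>)"
| Store: "exec (Store A a b) \<sigma> (1 + acost a + acost b)
    (\<sigma>\<lparr>arr := (arr \<sigma>)(A := (arr \<sigma> A)(aval a \<sigma> := aval b \<sigma>))\<rparr>)"
| Seq: "exec c \<sigma> t \<sigma>' \<Longrightarrow> exec d \<sigma>' u \<sigma>'' \<Longrightarrow> exec (Seq c d) \<sigma> (t + u) \<sigma>''"
| IfTrue: "bval b \<sigma> \<Longrightarrow> exec c \<sigma> t \<sigma>' \<Longrightarrow> exec (IfElse b c d) \<sigma> (1 + bcost b + t) \<sigma>'"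
| IfFalse: "\<not> bval b \<sigma> \<Longrightarrow> exec d \<sigma> t \<sigma>' \<Longrightarrow> exec (IfElse b c d) \<sigma> (1 + bcost b + t) \<sigma>'"
| WhileFalse: "\<not> bval b \<sigma> \<Longrightarrow> exec (While b c) \<sigma> (1 + bcost b) \<sigma>"
| WhileTrue: "bval b \<sigma> \<Longrightarrow> exec c \<sigma> t \<sigma>' \<Longrightarrow> exec (While b c) \<sigma>' u \<sigma>'' \<Longrightarrow>
    exec (While b c) \<sigma> (1 + bcost b + t + u) \<sigma>''"

inductive_cases exec_SkipE: "exec Skip \<sigma> t \<sigma>'"
inductive_cases exec_AssignE: "exec (Assign x a) \<sigma> t \<sigma>'"
inductive_cases exec_StoreE: "exec (Store A a b) \<sigma> t \<sigma>'"
inductive_cases exec_SeqE: "exec (Seq c d) \<sigma> t \<sigma>'"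
inductive_cases exec_IfElseE: "exec (IfElse b c d) \<sigma> t \<sigma>'"
inductive_cases exec_WhileE: "exec (While b c) \<sigma> t \<sigma>'"

lemma exec_deterministic:
  "exec c \<sigma> t \<sigma>' \<Longrightarrow> exec c \<sigma> u \<sigma>'' \<Longrightarrow> t = u \<and> \<sigma>' = \<sigma>''"
proof (induction arbitrary: u \<sigma>'' rule: exec.induct)
  case (Skip \<sigma>)
  then show ?case by (rule exec_SkipE) simp
next
  case (Assign x a \<sigma>)
  then show ?case by (rule exec_AssignE) simp
next
  case (Store A a b \<sigma>)
  then show ?case by (rule exec_StoreE) simp
next
  case (Seq c \<sigma> t \<sigma>' d v \<tau>)
  from Seq.prems obtain t1 \<sigma>1 u1
    where "u = t1 + u1" "exec c \<sigma> t1 \<sigma>1" "exec d \<sigma>1 u1 \<sigma>''" by (rule exec_SeqE)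
  with Seq.IH show ?case by metis
next
  case (IfTrue b \<sigma> c t \<sigma>' d)
  from IfTrue.prems obtain t1 where "u = 1 + bcost b + t1" "exec c \<sigma> t1 \<sigma>''"
    by (rule exec_IfElseE) (simp_all add: IfTrue.hyps)
  with IfTrue.IH show ?case by metis
next
  case (IfFalse b \<sigma> d t \<sigma>' c)
  from IfFalse.prems obtain t1 where "u = 1 + bcost b + t1" "exec d \<sigma> t1 \<sigma>''"
    by (rule exec_IfElseE) (simp_all add: IfFalse.hyps)
  with IfFalse.IH show ?case by metis
next
  case (WhileFalse b \<sigma> c)
  from WhileFalse.prems show ?case
    by (rule exec_WhileE) (simp_all add: WhileFalse.hyps)
next
  case (WhileTrue b \<sigma> c t \<sigma>' v \<tau>)
  from WhileTrue.prems obtain t1 \<sigma>1 u1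
    where "u = 1 + bcost b + t1 + u1" "exec c \<sigma> t1 \<sigma>1" "exec (While b c) \<sigma>1 u1 \<sigma>''"
    by (rule exec_WhileE) (simp_all add: WhileTrue.hyps)
  with WhileTrue.IH show ?case by metis
qed


section \<open>Input and output format\<close>

text \<open>
  The students are numbered \<open>0, \<dots>, m - 1\<close> and the questions \<open>0, \<dots>, r - 1\<close>. Registers 0, 1, 2
  hold \<open>m\<close>, \<open>r\<close>, \<open>k\<close>; arrays 0 and 1 hold the two initial orderings, and array 2 holds the
  adjacency matrix in row-major order. All other registers and array cells are 0. The program
  leaves the set of edits in array 3, again as a 0/1 matrix in row-major order.
\<close>

definition input_store ::
  "nat \<Rightarrow> nat \<Rightarrow> (nat \<times> nat) set \<Rightarrow> (nat \<Rightarrow> nat) \<Rightarrow> (nat \<Rightarrow> nat) \<Rightarrow> nat \<Rightarrow> store" where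
  "input_store m r E \<alpha> \<gamma> k =
     \<lparr> reg = (\<lambda>_. 0)(0 := m, 1 := r, 2 := k),
       arr = (\<lambda>_ _. 0)
         (0 := (\<lambda>i. if i < m then \<alpha> i else 0),
          1 := (\<lambda>j. if j < r then \<gamma> j else 0),
          2 := (\<lambda>p. if p < m * r \<and> (p div r, p mod r) \<in> E then 1 else 0)) \<rparr>"

definition output_set :: "nat \<Rightarrow> nat \<Rightarrow> store \<Rightarrow> (nat \<times> nat) set" where
  "output_set m r \<sigma> = {(i, j). i < m \<and> j < r \<and> arr \<sigma> 3 (i * r + j) = 1}"

end

theory Submission imports Defs begin

text \<open>
  An optimal solution is a pair of near orderings together with a staircase: inserting students
  and questions one by one along a monotone lattice path, a student is joined to exactly the
  questions inserted before it. For a near ordering the set of the first \<open>i\<close> elements contains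
  everything of initial position at most \<open>i - k\<close> and nothing beyond \<open>i + k\<close>, so it is described by
  \<open>i\<close> and a bit mask of width \<open>2 * k\<close>. Dynamic programming over pairs of such states has
  \<open>O(n\<^sup>2 * 16 ^ k)\<close> cells with \<open>O(n)\<close> transitions each, and \<open>16 ^ k\<close> is dominated by
  \<open>k ^ (4 * k)\<close> up to a constant.
\<close>

section \<open>For-loop programs\<close>

text \<open>The two orderings are chosen separately, but nestedness makes degrees grow along \<pi>
  and the interval property makes every neighbourhood a prefix of \<beta>; this is why one lattice
  path captures a solution. The cost of inserting a student depends on the current question state
  alone, so it is tabulated beforehand. Transitions then take constant time, which keeps the
  exponent of \<open>n\<close> at 3. Most masks are not the window of a genuine prefix, and none of
  these is filtered out. A walk from the full set back to count 0 removes one new element per step,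
  so counting alone shows that it lists everything once: spurious masks cannot produce a false
  solution, while the masks of real prefixes supply the matching bound on the optimum. A
  neighbourhood is fixed by a whole question state, mask included, so that state is recorded for
  each student on the way back. The machine cannot multiply, divide or shift, hence running indices,
  stored offsets and bits peeled off by subtraction. Restricting programs to counted loops makes
  evaluation a total function and turns running time into a syntactic bound in the loop
  limits.\<close>

definition setr :: "nat \<Rightarrow> nat \<Rightarrow> store \<Rightarrow> store" where
  "setr x v \<sigma> = \<sigma>\<lparr>reg := (reg \<sigma>)(x := v)\<rparr>"

definition seta :: "nat \<Rightarrow> nat \<Rightarrow> nat \<Rightarrow> store \<Rightarrow> store" where
  "seta A i v \<sigma> = \<sigma>\<lparr>arr := (arr \<sigma>)(A := (arr \<sigma> A)(i := v))\<rparr>"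

lemma store_simps [simp]:
  "reg (setr x v \<sigma>) = (reg \<sigma>)(x := v)"
  "arr (setr x v \<sigma>) = arr \<sigma>"
  "reg (seta A i v \<sigma>) = reg \<sigma>"
  "arr (seta A i v \<sigma>) = (arr \<sigma>)(A := (arr \<sigma> A)(i := v))"
  by (simp_all add: setr_def seta_def)

text \<open>Evaluation reads a loop limit once, the compiled while loop rereads it in every round.
  The two agree as long as the body overwrites neither limit nor counter, which is what
  \<open>counters_ok\<close> and the disjointness of \<open>limits\<close> and \<open>wregs\<close>
  express.\<close>

datatype prog =
    PSkip
  | PAssign nat aexp
  | PStore nat aexp aexp
  | PSeq prog prog (infixr ";;" 60)
  | PIf bexp prog prog
  | PFor nat nat prog

fun compile :: "prog \<Rightarrow> com" where
  "compile PSkip = Skip"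
| "compile (PAssign x a) = Assign x a"
| "compile (PStore A a b) = Store A a b"
| "compile (p ;; q) = Seq (compile p) (compile q)"
| "compile (PIf b p q) = IfElse b (compile p) (compile q)"
| "compile (PFor x l p) = Seq (Assign x (Const 0))
     (While (Less (Reg x) (Reg l)) (Seq (compile p) (Assign x (Plus (Reg x) (Const 1)))))"

primrec ev :: "prog \<Rightarrow> store \<Rightarrow> store" where
  "ev PSkip \<sigma> = \<sigma>"
| "ev (PAssign x a) \<sigma> = setr x (aval a \<sigma>) \<sigma>"
| "ev (PStore A a b) \<sigma> = seta A (aval a \<sigma>) (aval b \<sigma>) \<sigma>"
| "ev (p ;; q) \<sigma> = ev q (ev p \<sigma>)"
| "ev (PIf b p q) \<sigma> = (if bval b \<sigma> then ev p \<sigma> else ev q \<sigma>)"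
| "ev (PFor x l p) \<sigma> = rec_nat (setr x 0 \<sigma>) (\<lambda>i \<tau>. setr x (Suc i) (ev p \<tau>)) (reg \<sigma> l)"

primrec wregs :: "prog \<Rightarrow> nat set" where
  "wregs PSkip = {}"
| "wregs (PAssign x a) = {x}"
| "wregs (PStore A a b) = {}"
| "wregs (p ;; q) = wregs p \<union> wregs q"
| "wregs (PIf b p q) = wregs p \<union> wregs q"
| "wregs (PFor x l p) = insert x (wregs p)"

primrec warrs :: "prog \<Rightarrow> nat set" where
  "warrs PSkip = {}"
| "warrs (PAssign x a) = {}"
| "warrs (PStore A a b) = {A}"
| "warrs (p ;; q) = warrs p \<union> warrs q"
| "warrs (PIf b p q) = warrs p \<union> warrs q"
| "warrs (PFor x l p) = warrs p"

primrec limits :: "prog \<Rightarrow> nat set" where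
  "limits PSkip = {}"
| "limits (PAssign x a) = {}"
| "limits (PStore A a b) = {}"
| "limits (p ;; q) = limits p \<union> limits q"
| "limits (PIf b p q) = limits p \<union> limits q"
| "limits (PFor x l p) = insert l (limits p)"

primrec counters_ok :: "prog \<Rightarrow> bool" where
  "counters_ok PSkip \<longleftrightarrow> True"
| "counters_ok (PAssign x a) \<longleftrightarrow> True"
| "counters_ok (PStore A a b) \<longleftrightarrow> True"
| "counters_ok (p ;; q) \<longleftrightarrow> counters_ok p \<and> counters_ok q"
| "counters_ok (PIf b p q) \<longleftrightarrow> counters_ok p \<and> counters_ok q"
| "counters_ok (PFor x l p) \<longleftrightarrow> counters_ok p \<and> x \<notin> wregs p"

text \<open>Both branches of a conditional are charged, so the bound depends on the store only
  through the loop limits. In the loop clause, 6 pays for the initial assignment and the failing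
  last test, 8 for the test and the increment of one round.\<close>

primrec time :: "prog \<Rightarrow> (nat \<Rightarrow> nat) \<Rightarrow> nat" where
  "time PSkip \<rho> = 1"
| "time (PAssign x a) \<rho> = 1 + acost a"
| "time (PStore A a b) \<rho> = 1 + acost a + acost b"
| "time (p ;; q) \<rho> = time p \<rho> + time q \<rho>"
| "time (PIf b p q) \<rho> = 1 + bcost b + (time p \<rho> + time q \<rho>)"
| "time (PFor x l p) \<rho> = 6 + \<rho> l * (time p \<rho> + 8)"

lemma reg_ev [simp]: "y \<notin> wregs p \<Longrightarrow> reg (ev p \<sigma>) y = reg \<sigma> y"
proof (induction p arbitrary: \<sigma>)
  case (PFor x l p)
  have "reg (rec_nat (setr x 0 \<sigma>) (\<lambda>i \<tau>. setr x (Suc i) (ev p \<tau>)) n) y = reg \<sigma> y" for n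
    by (induction n) (use PFor in auto)
  then show ?case by simp
qed auto

lemma arr_ev [simp]: "A \<notin> warrs p \<Longrightarrow> arr (ev p \<sigma>) A = arr \<sigma> A"
proof (induction p arbitrary: \<sigma>)
  case (PFor x l p)
  have "arr (rec_nat (setr x 0 \<sigma>) (\<lambda>i \<tau>. setr x (Suc i) (ev p \<tau>)) n) A = arr \<sigma> A" for n
    by (induction n) (use PFor in auto)
  then show ?case by simp
qed auto

lemma time_cong: "(\<And>y. y \<in> limits p \<Longrightarrow> \<rho> y = \<rho>' y) \<Longrightarrow> time p \<rho> = time p \<rho>'"
  by (induction p) auto

lemma exec_ev:
  assumes "counters_ok p" "limits p \<inter> wregs p = {}"
  shows "\<exists>t \<le> time p (reg \<sigma>). exec (compile p) \<sigma> t (ev p \<sigma>)"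
  using assms
proof (induction p arbitrary: \<sigma>)
  case PSkip
  show ?case using exec.Skip[of \<sigma>] by auto
next
  case (PAssign x a)
  show ?case using exec.Assign[of x a \<sigma>] by (auto simp: setr_def)
next
  case (PStore A a b)
  show ?case using exec.Store[of A a b \<sigma>] by (auto simp: seta_def)
next
  case (PSeq p q)
  have "time q (reg (ev p \<sigma>)) = time q (reg \<sigma>)"
    by (rule time_cong, rule reg_ev) (use PSeq.prems in auto)
  moreover obtain t where "t \<le> time p (reg \<sigma>)" "exec (compile p) \<sigma> t (ev p \<sigma>)"
    using PSeq.IH(1)[of \<sigma>] PSeq.prems by auto
  moreover obtain u where "u \<le> time q (reg (ev p \<sigma>))"
    "exec (compile q) (ev p \<sigma>) u (ev q (ev p \<sigma>))"
    using PSeq.IH(2)[of "ev p \<sigma>"] PSeq.prems by auto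
  ultimately show ?case by (auto intro!: exI[of _ "t + u"] exec.Seq)
next
  case (PIf b p q)
  obtain t where "t \<le> time p (reg \<sigma>)" "exec (compile p) \<sigma> t (ev p \<sigma>)"
    using PIf.IH(1)[of \<sigma>] PIf.prems by auto
  moreover obtain u where "u \<le> time q (reg \<sigma>)" "exec (compile q) \<sigma> u (ev q \<sigma>)"
    using PIf.IH(2)[of \<sigma>] PIf.prems by auto
  ultimately show ?case
    using exec.IfTrue[of b \<sigma> "compile p" t "ev p \<sigma>" "compile q"]
      exec.IfFalse[of b \<sigma> "compile q" u "ev q \<sigma>" "compile p"]
    by (cases "bval b \<sigma>") (fastforce intro: exI[of _ "1 + bcost b + t"] exI[of _ "1 + bcost b + u"])+
next
  case (PFor x l p)
  define f where "f = rec_nat (setr x 0 \<sigma>) (\<lambda>i \<tau>. setr x (Suc i) (ev p \<tau>))"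
  have f_simps: "f 0 = setr x 0 \<sigma>" "\<And>i. f (Suc i) = setr x (Suc i) (ev p (f i))"
    by (simp_all add: f_def)
  define T where "T = time p (reg \<sigma>)"
  let ?body = "Seq (compile p) (Assign x (Plus (Reg x) (Const 1)))"
  have x: "x \<notin> wregs p" "x \<noteq> l" "l \<notin> wregs p" using PFor.prems by auto
  have fx: "reg (f i) x = i" for i by (cases i) (auto simp: f_simps)
  have fr: "reg (f i) y = reg \<sigma> y" if "y \<notin> insert x (wregs p)" for i y
    by (induction i) (use that in \<open>auto simp: f_simps\<close>)
  have fl: "reg (f i) l = reg \<sigma> l" for i by (rule fr) (use x in auto)
  have body: "\<exists>t \<le> T + 4. exec ?body (f i) t (f (Suc i))" for i
  proof -
    \<comment> \<open>No limit of the body is written by the loop, so each round obeys the bound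
      computed in the initial store.\<close>
    have "time p (reg (f i)) = T"
      unfolding T_def by (rule time_cong, rule fr) (use PFor.prems in auto)
    then obtain t where t: "t \<le> T" "exec (compile p) (f i) t (ev p (f i))"
      using PFor.IH[of "f i"] PFor.prems by auto
    moreover have "exec (Assign x (Plus (Reg x) (Const 1))) (ev p (f i)) 4 (f (Suc i))"
      using exec.Assign[of x "Plus (Reg x) (Const 1)" "ev p (f i)"] x fx[of i]
      by (simp add: f_simps setr_def eval_nat_numeral)
    ultimately have "exec ?body (f i) (t + 4) (f (Suc i))" by (rule_tac exec.Seq)
    with t show ?thesis by (intro exI[of _ "t + 4"]) auto
  qed
  have loop: "\<exists>t \<le> 4 + d * (T + 8). exec (While (Less (Reg x) (Reg l)) ?body) (f i) t (f (reg \<sigma> l))"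
    if "i + d = reg \<sigma> l" for d i
    using that
  proof (induction d arbitrary: i)
    case 0
    then have "exec (While (Less (Reg x) (Reg l)) ?body) (f i) (1 + bcost (Less (Reg x) (Reg l))) (f i)"
      by (intro exec.WhileFalse) (auto simp: fx fl)
    with 0 show ?case by (intro exI[of _ 4]) (auto simp: eval_nat_numeral)
  next
    case (Suc d)
    obtain t where t: "t \<le> T + 4" "exec ?body (f i) t (f (Suc i))" using body by blast
    obtain u where u: "u \<le> 4 + d * (T + 8)"
      "exec (While (Less (Reg x) (Reg l)) ?body) (f (Suc i)) u (f (reg \<sigma> l))"
      using Suc.IH[of "Suc i"] Suc.prems by auto
    have "exec (While (Less (Reg x) (Reg l)) ?body) (f i)
        (1 + bcost (Less (Reg x) (Reg l)) + t + u) (f (reg \<sigma> l))"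
      by (rule exec.WhileTrue[OF _ t(2) u(2)]) (use Suc.prems in \<open>auto simp: fx fl\<close>)
    with t u show ?case by (intro exI[of _ "1 + bcost (Less (Reg x) (Reg l)) + t + u"]) auto
  qed
  obtain t where t: "t \<le> 4 + reg \<sigma> l * (T + 8)"
    "exec (While (Less (Reg x) (Reg l)) ?body) (f 0) t (f (reg \<sigma> l))"
    using loop[of 0 "reg \<sigma> l"] by auto
  have "exec (Assign x (Const 0)) \<sigma> 2 (f 0)"
    using exec.Assign[of x "Const 0" \<sigma>] by (simp add: f_simps setr_def numeral_2_eq_2)
  from exec.Seq[OF this t(2)] have "exec (compile (PFor x l p)) \<sigma> (2 + t) (f (reg \<sigma> l))"
    by simp
  moreover have "ev (PFor x l p) \<sigma> = f (reg \<sigma> l)" by (simp add: f_def)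
  ultimately show ?case using t by (intro exI[of _ "2 + t"]) (auto simp: T_def)
qed

text \<open>The step case receives the frame facts of the whole loop, so an invariant only has to
  mention what the loop changes.\<close>

lemma for_invariant:
  assumes "I 0 (setr x 0 \<sigma>)"
    and "\<And>i \<tau>. \<lbrakk>i < reg \<sigma> l; I i \<tau>; reg \<tau> x = i;
        \<And>y. y \<notin> wregs (PFor x l p) \<Longrightarrow> reg \<tau> y = reg \<sigma> y;
        \<And>A. A \<notin> warrs p \<Longrightarrow> arr \<tau> A = arr \<sigma> A\<rbrakk> \<Longrightarrow> I (Suc i) (setr x (Suc i) (ev p \<tau>))"
  shows "I (reg \<sigma> l) (ev (PFor x l p) \<sigma>)"
proof -
  define f where "f = rec_nat (setr x 0 \<sigma>) (\<lambda>i \<tau>. setr x (Suc i) (ev p \<tau>))"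
  have f_simps: "f 0 = setr x 0 \<sigma>" "\<And>i. f (Suc i) = setr x (Suc i) (ev p (f i))"
    by (simp_all add: f_def)
  have fx: "reg (f i) x = i" for i by (cases i) (auto simp: f_simps)
  have fr: "reg (f i) y = reg \<sigma> y" if "y \<notin> wregs (PFor x l p)" for i y
    by (induction i) (use that in \<open>auto simp: f_simps\<close>)
  have fa: "arr (f i) A = arr \<sigma> A" if "A \<notin> warrs p" for i A
    by (induction i) (use that in \<open>auto simp: f_simps\<close>)
  have "i \<le> reg \<sigma> l \<Longrightarrow> I i (f i)" for i
  proof (induction i)
    case 0 show ?case using assms(1) by (simp add: f_simps)
  next
    case (Suc i)
    then have "I i (f i)" by simp
    then show ?case unfolding f_simps by (intro assms(2)) (use Suc.prems fx fr fa in auto)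
  qed
  then show ?thesis by (simp add: f_def)
qed

section \<open>Prefixes of near orderings\<close>

text \<open>
  The state \<open>x = i * 2 ^ (2 * k) + a\<close> stands for a set of \<open>i\<close> elements; bit \<open>p\<close> of \<open>a\<close> tells
  whether the element of initial position \<open>i + 1 + p - k\<close> belongs to it, with nonexistent
  positions \<open>\<le> 0\<close> counted in and those \<open>> n\<close> counted out. Bit \<open>p\<close> of \<open>2 * a + 1\<close> does the
  same for position \<open>i + p - k\<close>; clearing one of its bits yields the mask of the state for \<open>i - 1\<close>.
  A predecessor \<open>x'\<close> is returned as \<open>Suc x'\<close>, and \<open>0\<close> means that there is none.
\<close>

definition member :: "nat \<Rightarrow> (nat \<Rightarrow> nat) \<Rightarrow> nat \<Rightarrow> nat \<Rightarrow> bool" where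
  "member k f x s \<longleftrightarrow> f s + k < x div 2 ^ (2 * k) \<or>
     bit (2 * (x mod 2 ^ (2 * k)) + 1) (f s + k - x div 2 ^ (2 * k))"

definition predecessor :: "nat \<Rightarrow> (nat \<Rightarrow> nat) \<Rightarrow> nat \<Rightarrow> nat \<Rightarrow> nat" where
  "predecessor k f x s =
    (let i = x div 2 ^ (2 * k); w = 2 * (x mod 2 ^ (2 * k)) + 1; p = f s + k - i
     in if 0 < i \<and> i \<le> f s + k \<and> bit w p \<and> w - 2 ^ p < 2 ^ (2 * k)
        then Suc ((i - 1) * 2 ^ (2 * k) + (w - 2 ^ p)) else 0)"

section \<open>Bits of masks and the removal of the last element\<close>

lemma bit_minus_exp_nat:
  fixes w :: nat
  assumes "bit w p"
  shows "bit (w - 2 ^ p) q \<longleftrightarrow> bit w q \<and> q \<noteq> p"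
proof -
  have "int (unset_bit p w) = int w - 2 ^ p"
    using assms by (simp add: of_nat_unset_bit_eq unset_bit_eq bit_of_nat_iff_bit)
  then have "unset_bit p w = w - 2 ^ p"
    by (metis nat_int of_nat_diff of_nat_numeral of_nat_power of_nat_0_le_iff diff_ge_0_iff_ge
        of_nat_le_iff)
  then show ?thesis by (metis bit_unset_bit_iff)
qed

lemma bit_odd_nat: "bit (2 * a + 1 :: nat) q \<longleftrightarrow> q = 0 \<or> bit a (q - 1)"
  by (cases q) (simp_all add: bit_Suc bit_0)

lemma bit_ones_nat: "bit (2 ^ k - 1 :: nat) p \<longleftrightarrow> p < k"
  using bit_mask_iff[of k p, where 'a = nat] by (simp add: mask_eq_exp_minus_1)

lemma ones_less: "2 ^ k - 1 < (2 :: nat) ^ (2 * k)"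
  by (rule less_le_trans[of _ "2 ^ k"]) (auto intro: power_increasing)

lemma bit_index_less_nat:
  fixes w :: nat
  assumes "bit w p" "w < 2 ^ n"
  shows "p < n"
  using assms by (metis bit_take_bit_iff take_bit_nat_eq_self)

text \<open>The low bits of \<open>2 * a + 1\<close> already start at the first position of the
  window for \<open>i - 1\<close>, so clearing bit \<open>p\<close> is the whole transition. The
  guard \<open>w - 2 ^ p < 2 ^ (2 * k)\<close> says that position \<open>i + k\<close>, which that
  smaller window does not reach, is unoccupied after the removal. Nearness comes for free:
  \<open>w\<close> has \<open>2 * k + 1\<close> bits, which bounds \<open>p\<close>, and the other
  inequality is a guard.\<close>

lemma predecessor_Suc:
  assumes "predecessor k f x s = Suc x'"
  shows predecessor_div: "x div 2 ^ (2 * k) = Suc (x' div 2 ^ (2 * k))"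
    and predecessor_less: "x' < x"
    and predecessor_near: "f s \<le> x div 2 ^ (2 * k) + k" "x div 2 ^ (2 * k) \<le> f s + k"
    and predecessor_member: "member k f x s"
    and member_predecessor: "\<And>t. member k f x' t \<longleftrightarrow> member k f x t \<and> f t \<noteq> f s"
proof -
  define W :: nat where "W = 2 ^ (2 * k)"
  define i where "i = x div W"
  define a where "a = x mod W"
  define w where "w = 2 * a + 1"
  define p where "p = f s + k - i"
  have *: "0 < i" "i \<le> f s + k" "bit w p" "w - 2 ^ p < W" "x' = (i - 1) * W + (w - 2 ^ p)"
    using assms unfolding predecessor_def Let_def W_def i_def a_def w_def p_def
    by (auto split: if_splits)
  have W: "W > 0" by (simp add: W_def)
  have x': "x' div W = i - 1" "x' mod W = w - 2 ^ p" using *(4,5) W by auto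
  show 1: "x div 2 ^ (2 * k) = Suc (x' div 2 ^ (2 * k))"
    using x' * by (simp add: W_def i_def)
  show "x' < x" using 1 by (metis div_le_mono lessI not_less)
  show "x div 2 ^ (2 * k) \<le> f s + k" using * by (simp add: W_def i_def)
  have "a < W" using W by (simp add: a_def)
  then have "w < 2 ^ (2 * k + 1)" by (simp add: w_def W_def)
  then have "p < 2 * k + 1" using bit_index_less_nat *(3) by blast
  then show "f s \<le> x div 2 ^ (2 * k) + k" using * by (simp add: W_def i_def p_def)
  show "member k f x s" using * unfolding member_def W_def i_def a_def w_def p_def by simp
  show "member k f x' t \<longleftrightarrow> member k f x t \<and> f t \<noteq> f s" for t
  proof (cases "f t + k < i")
    case True
    then have "member k f x t" "f t \<noteq> f s" using * by (auto simp: member_def W_def i_def)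
    moreover have "member k f x' t"
      using True x' unfolding member_def W_def[symmetric] bit_odd_nat by auto
    ultimately show ?thesis by simp
  next
    case False
    then have "f t + k - (i - 1) = Suc (f t + k - i)" using * by simp
    then have "member k f x' t \<longleftrightarrow> bit (w - 2 ^ p) (f t + k - i)"
      using False x' unfolding member_def W_def[symmetric] bit_odd_nat by auto
    also have "\<dots> \<longleftrightarrow> bit w (f t + k - i) \<and> f t + k - i \<noteq> p"
      using * by (simp add: bit_minus_exp_nat)
    also have "\<dots> \<longleftrightarrow> member k f x t \<and> f t \<noteq> f s"
      using False * unfolding member_def W_def[symmetric] i_def[symmetric] a_def[symmetric]
        w_def[symmetric] by (auto simp: p_def)
    finally show ?thesis .
  qed
qed

lemma predecessor_first: "x < 2 ^ (2 * k) \<Longrightarrow> predecessor k f x s = 0"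
  by (simp add: predecessor_def)

text \<open>The low \<open>k\<close> bits stand for positions at most \<open>n\<close>, the others
  for positions beyond \<open>n\<close>. For \<open>n = 0\<close> the low bits are the nonexistent
  positions counted in, so the empty set has the same mask.\<close>

definition final_state :: "nat \<Rightarrow> nat \<Rightarrow> nat" where
  "final_state k n = n * 2 ^ (2 * k) + (2 ^ k - 1)"

lemma final_state_div [simp]: "final_state k n div 2 ^ (2 * k) = n"
  and final_state_mod [simp]: "final_state k n mod 2 ^ (2 * k) = 2 ^ k - 1"
proof -
  have "(n * W + c) div W = n" "(n * W + c) mod W = c" if "c < W" for c W :: nat
    using that by simp_all
  from this[OF ones_less]
  show "final_state k n div 2 ^ (2 * k) = n" "final_state k n mod 2 ^ (2 * k) = 2 ^ k - 1"
    unfolding final_state_def by simp_all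
qed

lemma member_final_state:
  "f s \<le> n \<Longrightarrow> member k f (final_state k n) s"
  unfolding member_def by (auto simp: bit_odd_nat bit_ones_nat simp del: One_nat_def)

section \<open>Near orderings as walks through the states\<close>

lemma orderingD:
  assumes "ordering_of {..<n} f"
  shows ordering_inj: "inj_on f {..<n}"
    and ordering_ge: "s < n \<Longrightarrow> 1 \<le> f s"
    and ordering_le: "s < n \<Longrightarrow> f s \<le> n"
    and ordering_surj: "1 \<le> v \<Longrightarrow> v \<le> n \<Longrightarrow> \<exists>s<n. f s = v"
proof -
  have *: "inj_on f {..<n}" "f ` {..<n} = {1..n}"
    using assms by (auto simp: ordering_of_def bij_betw_def)
  show "inj_on f {..<n}" by (rule *)
  show "s < n \<Longrightarrow> 1 \<le> f s" "s < n \<Longrightarrow> f s \<le> n" using *(2) by force+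
  show "1 \<le> v \<Longrightarrow> v \<le> n \<Longrightarrow> \<exists>s<n. f s = v"
    using *(2) by (metis atLeastAtMost_iff imageE lessThan_iff)
qed

text \<open>\<open>L\<close> lists the elements that a walk from \<open>x\<close> to the full set
  still adds, in order of insertion. The length equation ties their number to the count in
  \<open>x\<close>; it stands in for any condition that the mask of \<open>x\<close> comes from a
  genuine prefix.\<close>

definition tail :: "nat \<Rightarrow> (nat \<Rightarrow> nat) \<Rightarrow> nat \<Rightarrow> nat \<Rightarrow> nat list \<Rightarrow> bool" where
  "tail k f n x L \<longleftrightarrow> distinct L \<and> set L = {s. s < n \<and> \<not> member k f x s} \<and>
     x div 2 ^ (2 * k) + length L = n \<and>
     (\<forall>t<length L. f (L ! t) \<le> x div 2 ^ (2 * k) + Suc t + k \<and>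
        x div 2 ^ (2 * k) + Suc t \<le> f (L ! t) + k)"

lemma tail_final_state:
  "ordering_of {..<n} f \<Longrightarrow> tail k f n (final_state k n) []"
  by (auto simp: tail_def member_final_state ordering_le)

lemma tail_predecessor:
  assumes "ordering_of {..<n} f" "tail k f n x L" "predecessor k f x s = Suc x'" "s < n"
  shows "tail k f n x' (s # L)"
proof -
  have "f t = f s \<longleftrightarrow> t = s" if "t < n" for t
    using ordering_inj[OF assms(1)] that assms(4) by (auto dest: inj_onD)
  then have "set (s # L) = {t. t < n \<and> \<not> member k f x' t}"
    using assms(2,4) by (auto simp: tail_def member_predecessor[OF assms(3)])
  moreover have "s \<notin> set L"
    using assms(2) predecessor_member[OF assms(3)] by (auto simp: tail_def)
  ultimately show ?thesis
    using assms(2) predecessor_div[OF assms(3)] predecessor_near[OF assms(3)]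
    by (auto simp: tail_def nth_Cons split: nat.splits)
qed

text \<open>At count 0 the list consists of \<open>n\<close> distinct numbers below
  \<open>n\<close>, hence is a permutation, whatever the mask of \<open>x\<close> may be. Spurious
  masks therefore do no harm.\<close>

lemma tail_complete:
  assumes "tail k f n x L" "x div 2 ^ (2 * k) = 0"
  shows "set L = {..<n}" "length L = n"
    and "\<exists>\<pi>. ordering_of {..<n} \<pi> \<and> near k {..<n} f \<pi> \<and> (\<forall>t<n. \<pi> (L ! t) = Suc t)"
proof -
  show l: "length L = n" using assms by (simp add: tail_def)
  have d: "distinct L" using assms by (simp add: tail_def)
  show s: "set L = {..<n}"
  proof (rule card_subset_eq)
    show "set L \<subseteq> {..<n}" using assms by (auto simp: tail_def)
    show "card (set L) = card {..<n}" using l distinct_card[OF d] by simp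
  qed simp
  have bij: "bij_betw ((!) L) {..<n} {..<n}"
    by (rule bij_betw_nth[OF d]) (simp_all only: l s)
  define \<pi> where "\<pi> = Suc \<circ> the_inv_into {..<n} ((!) L)"
  have \<pi>: "\<pi> (L ! t) = Suc t" if "t < n" for t
    using bij that by (simp add: \<pi>_def the_inv_into_f_f bij_betw_def)
  have "bij_betw \<pi> {..<n} {1..n}"
    unfolding \<pi>_def
    by (rule bij_betw_trans[OF bij_betw_the_inv_into[OF bij]])
      (simp add: bij_betw_def image_Suc_lessThan)
  then have "ordering_of {..<n} \<pi>" by (simp add: ordering_of_def)
  moreover have "near k {..<n} f \<pi>"
    unfolding near_def
  proof
    fix v assume "v \<in> {..<n}"
    then obtain t where "t < n" "v = L ! t" using s l by (metis in_set_conv_nth)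
    then show "int (\<pi> v) \<in> {int (f v) - int k..int (f v) + int k}"
      using assms l \<pi> by (force simp: tail_def)
  qed
  ultimately show "\<exists>\<pi>. ordering_of {..<n} \<pi> \<and> near k {..<n} f \<pi> \<and> (\<forall>t<n. \<pi> (L ! t) = Suc t)"
    using \<pi> by blast
qed

text \<open>Nearness confines the difference between a prefix of \<pi> and an initial segment of
  \<open>f\<close> to the window, so windows lose no information. Taking the true window of every
  prefix gives a walk along \<open>predecessor\<close> between the two prescribed end
  states.\<close>

lemma ordering_states:
  assumes f: "ordering_of {..<n} f" and \<pi>: "ordering_of {..<n} \<pi>"
    and near: "near k {..<n} f \<pi>" and k: "k > 0"
  obtains X where "X 0 = final_state k 0" "X n = final_state k n"
    "\<And>i. X i div 2 ^ (2 * k) = i"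
    "\<And>i s. s < n \<Longrightarrow> \<pi> s = Suc i \<Longrightarrow> predecessor k f (X (Suc i)) s = Suc (X i)"
    "\<And>i s. s < n \<Longrightarrow> member k f (X i) s \<longleftrightarrow> \<pi> s \<le> i"
proof -
  \<comment> \<open>The first disjunct is the convention for positions \<open>i + 1 + p - k\<close>
    that are at most 0; the equation in the second avoids truncated subtraction.\<close>
  define b where "b i p \<longleftrightarrow> i + p < k \<or> (\<exists>s<n. f s + k = Suc (i + p) \<and> \<pi> s \<le> i)" for i p
  define a :: "nat \<Rightarrow> nat" where "a i = horner_sum of_bool 2 (map (b i) [0..<2 * k])" for i
  have bit_a: "bit (a i) p \<longleftrightarrow> p < 2 * k \<and> b i p" for i p
    by (auto simp: a_def bit_horner_sum_bit_iff)
  have "take_bit (2 * k) (a i) = a i" for i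
    by (simp add: a_def take_bit_horner_sum_bit_eq)
  then have a_less: "a i < 2 ^ (2 * k)" for i
    by (metis take_bit_nat_less_exp)
  define X where "X i = i * 2 ^ (2 * k) + a i" for i
  have X: "X i div 2 ^ (2 * k) = i" "X i mod 2 ^ (2 * k) = a i" for i
    using a_less[of i] by (simp_all add: X_def)
  have nr: "f s \<le> \<pi> s + k" "\<pi> s \<le> f s + k" if "s < n" for s
    using near that by (force simp: near_def)+
  have a0: "a 0 = 2 ^ k - 1"
  proof (rule bit_eqI)
    fix p
    show "bit (a 0) p = bit (2 ^ k - 1 :: nat) p"
      using ordering_ge[OF \<pi>] unfolding bit_a bit_ones_nat b_def by fastforce
  qed
  have an: "a n = 2 ^ k - 1"
  proof (rule bit_eqI)
    fix p
    have "(\<exists>s<n. f s + k = Suc (n + p) \<and> \<pi> s \<le> n)" if "p < k" "k \<le> n + p"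
      using ordering_surj[OF f, of "Suc (n + p) - k"] that ordering_le[OF \<pi>] by force
    then show "bit (a n) p = bit (2 ^ k - 1 :: nat) p"
      using ordering_le[OF f] unfolding bit_a bit_ones_nat b_def by fastforce
  qed
  show thesis
  proof (rule that[of X])
    show "X 0 = final_state k 0" "X n = final_state k n"
      by (simp_all add: X_def a0 an final_state_def)
    show "X i div 2 ^ (2 * k) = i" for i by (rule X)
    show "member k f (X i) s \<longleftrightarrow> \<pi> s \<le> i" if s: "s < n" for i s
    proof (cases "f s + k \<le> i")
      case True
      then show ?thesis using nr[OF s] unfolding member_def X bit_odd_nat by auto
    next
      case False
      define p where "p = f s + k - i - 1"
      have p: "f s + k = Suc (i + p)" using False by (simp add: p_def)
      have "member k f (X i) s \<longleftrightarrow> p < 2 * k \<and> b i p"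
        using False unfolding member_def X bit_odd_nat bit_a p_def by auto
      also have "b i p \<longleftrightarrow> \<pi> s \<le> i"
      proof -
        have "t = s" if "t < n" "f t = f s" for t
          using that s ordering_inj[OF f] by (auto dest: inj_onD)
        then show ?thesis
          using p s ordering_ge[OF f s] unfolding b_def
          by (metis add_right_imp_eq add_leD2 not_less add_Suc_right less_Suc_eq_le
              add.commute nat_add_left_cancel_le not_less_eq_eq plus_1_eq_Suc)
      qed
      finally show ?thesis using p nr[OF s] by auto
    qed
    show "predecessor k f (X (Suc i)) s = Suc (X i)" if s: "s < n" "\<pi> s = Suc i" for i s
    proof -
      define w where "w = 2 * a (Suc i) + 1"
      define p where "p = f s + k - Suc i"
      have le: "Suc i \<le> f s + k" "f s \<le> Suc i + k" using nr[OF s(1)] s(2) by auto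
      have uniq: "t = s" if "t < n" "f t = f s \<or> \<pi> t = Suc i" for t
        using that s ordering_inj[OF f] ordering_inj[OF \<pi>] by (metis inj_onD lessThan_iff)
      have bw: "bit w q \<longleftrightarrow> q = 0 \<or> (q \<le> 2 * k \<and> b (Suc i) (q - 1))" for q
        unfolding w_def bit_odd_nat bit_a by auto
      have "bit w p"
        unfolding bw b_def using le s by (auto simp: p_def intro!: exI[of _ s])
      moreover have "w - 2 ^ p = a i"
      proof (rule bit_eqI)
        fix q
        \<comment> \<open>Bit 0 of \<open>w\<close> is the constant 1, so the matching element must
          be shown to belong to the prefix: it sits at position \<open>Suc i - k\<close>, and
          nearness gives it \<pi>-value at most \<open>Suc i\<close>.\<close>
        have low: "\<exists>t<n. f t + k = Suc i \<and> \<pi> t \<le> Suc i" if ki: "k \<le> i"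
        proof -
          have "Suc i \<le> n" using s ordering_le[OF \<pi>, of s] by simp
          then have "1 \<le> Suc i - k" "Suc i - k \<le> n" using ki by linarith+
          then obtain t where t: "t < n" "f t = Suc i - k"
            using ordering_surj[OF f] by blast
          then have "f t + k = Suc i" using ki by simp
          with t show ?thesis using nr(2)[of t] by auto
        qed
        have "bit w q \<and> q \<noteq> p \<longleftrightarrow> q < 2 * k \<and> b i q"
        proof (cases "i + q < k")
          case True
          then have "q \<noteq> p" using ordering_ge[OF f s(1)] by (auto simp: p_def)
          with True show ?thesis unfolding bw b_def by auto
        next
          case False
          have "bit w q \<longleftrightarrow> q \<le> 2 * k \<and> (\<exists>t<n. f t + k = Suc (i + q) \<and> \<pi> t \<le> Suc i)"
          proof (cases "q = 0")
            case True
            then show ?thesis using low False unfolding bw by simp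
          next
            case q: False
            then show ?thesis using False unfolding bw b_def by auto
          qed
          moreover have "(\<exists>t<n. f t + k = Suc (i + q) \<and> \<pi> t \<le> Suc i) \<and> q \<noteq> p \<longleftrightarrow>
              (\<exists>t<n. f t + k = Suc (i + q) \<and> \<pi> t \<le> i)"
          proof
            assume "(\<exists>t<n. f t + k = Suc (i + q) \<and> \<pi> t \<le> Suc i) \<and> q \<noteq> p"
            then obtain t where t: "t < n" "f t + k = Suc (i + q)" "\<pi> t \<le> Suc i" "q \<noteq> p" by blast
            then have "t \<noteq> s" using le by (auto simp: p_def)
            then have "\<pi> t \<noteq> Suc i" using uniq t by blast
            then show "\<exists>t<n. f t + k = Suc (i + q) \<and> \<pi> t \<le> i" using t by auto
          next
            assume "\<exists>t<n. f t + k = Suc (i + q) \<and> \<pi> t \<le> i"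
            then obtain t where t: "t < n" "f t + k = Suc (i + q)" "\<pi> t \<le> i" by blast
            have "q \<noteq> p"
            proof
              assume "q = p"
              then have "f t = f s" using t le by (auto simp: p_def)
              then show False using uniq[OF t(1)] t(3) s(2) by simp
            qed
            then show "(\<exists>t<n. f t + k = Suc (i + q) \<and> \<pi> t \<le> Suc i) \<and> q \<noteq> p"
              using t le_SucI by blast
          qed
          moreover have "q \<noteq> 2 * k" if "t < n" "f t + k = Suc (i + q)" "\<pi> t \<le> i" for t
            using nr(1)[OF that(1)] that by auto
          ultimately show ?thesis using False unfolding b_def by (metis le_neq_implies_less less_imp_le)
        qed
        then show "bit (w - 2 ^ p) q = bit (a i) q"
          by (simp add: bit_minus_exp_nat[OF \<open>bit w p\<close>] bit_a)
      qed
      ultimately show ?thesis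
        using le a_less[of i] unfolding predecessor_def Let_def X w_def[symmetric] p_def[symmetric]
        by (simp add: X_def)
    qed
  qed
qed

section \<open>Tabulating the state graphs\<close>

text \<open>
  Registers: 0--2 input \<open>m\<close>, \<open>r\<close>, \<open>k\<close>; 3 mask width \<open>2 * k + 1\<close>; 4 number \<open>2 ^ (2 * k)\<close> of masks;
  5 start state; 6, 7 \<open>m + 1\<close>, \<open>r + 1\<close>; 8, 9 numbers of student and question states; 10 \<open>m + r\<close>;
  11--17 loop counters \<open>i\<close>, \<open>a\<close>, \<open>t\<close>, student, question, student state, question state;
  21--23 the products (student state) \<open>* m\<close>, (question state) \<open>* m\<close>, (question state) \<open>* r\<close>;
  24 current table cell; the others are temporary.

  Arrays: 0--3 input and output; 4 powers of two; 5 decoded bits; 6, 7 membership and predecessor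
  of student states; 8, 9 the same for question states; 10 cost of a student at a question state;
  11 row offsets; 12 optimal cost plus one, where \<open>0\<close> means unreachable; 13--15 previous
  student state, previous question state, inserted student plus one; 16 question state at which
  a student was inserted; 17 multiples of \<open>r\<close>.
\<close>

abbreviation (input) "plus1 a \<equiv> Plus a (Const 1)"

section \<open>Bit decoding and the transition tables\<close>

definition p_decode :: prog where
  "p_decode = PFor 13 3 (
     PAssign 19 (Minus (Minus (Reg 3) (Const 1)) (Reg 13)) ;;
     PIf (Less (Reg 18) (Arr 4 (Reg 19)))
       (PStore 5 (Reg 19) (Const 0))
       (PStore 5 (Reg 19) (Const 1) ;; PAssign 18 (Minus (Reg 18) (Arr 4 (Reg 19)))))"

lemma p_decode_frame [simp]: "wregs p_decode = {13, 18, 19}" "warrs p_decode = {5}"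
  by (auto simp: p_decode_def)

text \<open>Without division, bits are found from the top down: the remainder in register 18 is
  compared with the next power of two, which is subtracted if it fits. After \<open>t\<close> rounds
  the remainder is the low part of the input that is still undecoded.\<close>

lemma p_decode:
  assumes pw: "\<And>u. u < reg \<sigma> 3 \<Longrightarrow> arr \<sigma> 4 u = 2 ^ u" and w: "reg \<sigma> 18 < 2 ^ reg \<sigma> 3"
    and zero: "\<And>p. p \<ge> reg \<sigma> 3 \<Longrightarrow> arr \<sigma> 5 p = 0"
  shows "arr (ev p_decode \<sigma>) 5 p = of_bool (bit (reg \<sigma> 18) p)"
proof -
  define K where "K = reg \<sigma> 3"
  define w where "w = reg \<sigma> 18"
  define I where "I t \<tau> \<longleftrightarrow> reg \<tau> 18 = take_bit (K - t) w \<and>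
     (\<forall>p \<ge> K - t. arr \<tau> 5 p = of_bool (bit w p))" for t and \<tau> :: store
  have "I (reg \<sigma> 3) (ev p_decode \<sigma>)"
    unfolding p_decode_def
  proof (rule for_invariant)
    have "w < 2 ^ K" using w by (simp add: w_def K_def)
    then show "I 0 (setr 13 0 \<sigma>)"
      using zero bit_index_less_nat[of w _ K]
      by (auto simp: I_def w_def[symmetric] K_def[symmetric] take_bit_nat_eq_self)
        (metis leD)
  next
    fix t \<tau>
    let ?body = "PAssign 19 (Minus (Minus (Reg 3) (Const 1)) (Reg 13)) ;;
     PIf (Less (Reg 18) (Arr 4 (Reg 19)))
       (PStore 5 (Reg 19) (Const 0))
       (PStore 5 (Reg 19) (Const 1) ;; PAssign 18 (Minus (Reg 18) (Arr 4 (Reg 19))))"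
    assume t: "t < reg \<sigma> 3" "I t \<tau>" "reg \<tau> 13 = t"
      and fr: "\<And>y. y \<notin> wregs (PFor 13 3 ?body) \<Longrightarrow> reg \<tau> y = reg \<sigma> y"
      and fa: "\<And>A. A \<notin> warrs ?body \<Longrightarrow> arr \<tau> A = arr \<sigma> A"
    define u where "u = K - 1 - t"
    have u: "K - t = Suc u" "K - Suc t = u" "u < K" using t by (auto simp: u_def K_def)
    have r: "reg \<tau> 3 - 1 - t = u" "arr \<tau> 4 u = 2 ^ u"
      using fr fa pw[of u] u by (simp_all add: K_def u_def)
    have wt: "reg \<tau> 18 = take_bit (Suc u) w" using t(2) by (simp add: I_def u)
    have "int (take_bit (Suc u) w) = int (2 ^ u * of_bool (bit w u) + take_bit u w)"
      by (simp add: of_nat_take_bit take_bit_Suc_from_most bit_of_nat_iff_bit)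
    then have tk: "take_bit (Suc u) w = 2 ^ u * of_bool (bit w u) + take_bit u w"
      by (simp only: of_nat_eq_iff)
    have lt: "take_bit u w < 2 ^ u" by simp
    have old: "arr \<tau> 5 p = of_bool (bit w p)" if "p \<ge> Suc u" for p
      using t(2) that by (simp add: I_def u)
    show "I (Suc t) (setr 13 (Suc t) (ev ?body \<tau>))"
      using lt old r by (auto simp: I_def t(3) u wt tk not_less_eq_eq dest: le_neq_implies_less)
  qed
  then show ?thesis by (simp add: I_def K_def w_def)
qed

definition p_fill :: "nat \<Rightarrow> nat \<Rightarrow> nat \<Rightarrow> nat \<Rightarrow> prog" where
  "p_fill n al me pr = PFor 14 n (
     PIf (Less (Plus (Arr al (Reg 14)) (Reg 2)) (Reg 11))
       (PStore me (Reg 20) (Const 1) ;; PStore pr (Reg 20) (Const 0))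
       (PAssign 25 (Minus (Plus (Arr al (Reg 14)) (Reg 2)) (Reg 11)) ;;
        PStore me (Reg 20) (Arr 5 (Reg 25)) ;;
        PIf (Conj (Less (Const 0) (Reg 11)) (Conj (Equal (Arr 5 (Reg 25)) (Const 1))
              (Less (Minus (plus1 (Plus (Reg 12) (Reg 12))) (Arr 4 (Reg 25))) (Reg 4))))
          (PStore pr (Reg 20) (Minus (Minus (Plus (Reg 16) (Plus (Reg 12) (Const 2))) (Reg 4)) (Arr 4 (Reg 25))))
          (PStore pr (Reg 20) (Const 0))) ;;
     PAssign 20 (plus1 (Reg 20)))"

lemma p_fill_frame [simp]:
  "wregs (p_fill n al me pr) = {14, 20, 25}" "warrs (p_fill n al me pr) = {me, pr}"
  by (auto simp: p_fill_def)

definition tables_ok :: "nat \<Rightarrow> nat \<Rightarrow> (nat \<Rightarrow> nat) \<Rightarrow> nat \<Rightarrow> nat \<Rightarrow> nat \<Rightarrow> store \<Rightarrow> bool" where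
  "tables_ok k n f me pr N \<sigma> \<longleftrightarrow>
     (\<forall>j<N. arr \<sigma> me j = of_bool (member k f (j div n) (j mod n)) \<and>
            arr \<sigma> pr j = predecessor k f (j div n) (j mod n))"

lemma p_fill:
  fixes n al me pr :: nat and \<sigma> :: store
  assumes distinct: "n \<notin> {14, 20, 25}" "me \<noteq> pr" "me \<notin> {al, 4, 5}" "pr \<notin> {al, 4, 5}"
    and k: "reg \<sigma> 2 = k" and W: "reg \<sigma> 4 = 2 ^ (2 * k)" and i: "reg \<sigma> 11 = i"
    and a: "reg \<sigma> 12 = a" "a < 2 ^ (2 * k)" and x: "reg \<sigma> 16 = i * 2 ^ (2 * k) + a"
    and N: "reg \<sigma> n = N" and idx: "reg \<sigma> 20 = reg \<sigma> 16 * N"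
    and f: "\<And>s. s < N \<Longrightarrow> arr \<sigma> al s = f s"
    and pw: "\<And>u. u < 2 * k + 1 \<Longrightarrow> arr \<sigma> 4 u = 2 ^ u"
    and bits: "\<And>p. arr \<sigma> 5 p = of_bool (bit (2 * a + 1) p)"
    and old: "tables_ok k N f me pr (reg \<sigma> 20) \<sigma>"
  shows "reg (ev (p_fill n al me pr) \<sigma>) 20 = Suc (reg \<sigma> 16) * N"
    "tables_ok k N f me pr (Suc (reg \<sigma> 16) * N) (ev (p_fill n al me pr) \<sigma>)"
proof -
  define X where "X = reg \<sigma> 16"
  have Xdm: "X div 2 ^ (2 * k) = i" "X mod 2 ^ (2 * k) = a" using x a(2) by (simp_all add: X_def)
  define I where "I s \<tau> \<longleftrightarrow> reg \<tau> 20 = X * N + s \<and> tables_ok k N f me pr (X * N + s) \<tau>"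
    for s and \<tau> :: store
  have "I (reg \<sigma> n) (ev (p_fill n al me pr) \<sigma>)"
    unfolding p_fill_def
  proof (rule for_invariant, goal_cases)
    case 1
    show ?case using old by (simp add: I_def idx X_def tables_ok_def)
  next
    case (2 s \<tau>)
    note fr = 2(4) and fa = 2(5)
    have s: "s < N" "reg \<tau> 14 = s" and I: "reg \<tau> 20 = X * N + s" "tables_ok k N f me pr (X * N + s) \<tau>"
      using 2 N by (auto simp: I_def)
    have r: "reg \<tau> 2 = k" "reg \<tau> 4 = 2 ^ (2 * k)" "reg \<tau> 11 = i" "reg \<tau> 12 = a" "reg \<tau> 16 = X"
      using fr k W i a by (simp_all add: X_def)
    have A: "arr \<tau> al s = f s" "\<And>u. u < 2 * k + 1 \<Longrightarrow> arr \<tau> 4 u = 2 ^ u"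
      "\<And>p. arr \<tau> 5 p = of_bool (bit (2 * a + 1) p)"
    proof -
      have "arr \<tau> al = arr \<sigma> al" "arr \<tau> 4 = arr \<sigma> 4" "arr \<tau> 5 = arr \<sigma> 5"
        by (rule fa; use distinct in auto)+
      then show "arr \<tau> al s = f s" "\<And>u. u < 2 * k + 1 \<Longrightarrow> arr \<tau> 4 u = 2 ^ u"
        "\<And>p. arr \<tau> 5 p = of_bool (bit (2 * a + 1) p)"
        using f[OF s(1)] pw bits by simp_all
    qed
    have dm: "(X * N + s) div N = X" "(X * N + s) mod N = s" using s by simp_all
    have p: "p < 2 * k + 1" if "bit (2 * a + 1) p" for p
      using a(2) by (intro bit_index_less_nat[OF that]) simp
    have mem: "member k f X s \<longleftrightarrow> f s + k < i \<or> bit (2 * a + 1) (f s + k - i)"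
      by (simp add: member_def Xdm)
    have prd: "predecessor k f X s =
        (if 0 < i \<and> i \<le> f s + k \<and> bit (2 * a + 1) (f s + k - i) \<and>
            2 * a + 1 - arr \<tau> 4 (f s + k - i) < 2 ^ (2 * k)
         then X + (a + 2) - 2 ^ (2 * k) - arr \<tau> 4 (f s + k - i) else 0)"
    proof (cases "0 < i \<and> i \<le> f s + k \<and> bit (2 * a + 1) (f s + k - i)")
      case True
      define q where "q = f s + k - i"
      have q: "arr \<tau> 4 q = 2 ^ q" using A(2) p True by (simp add: q_def)
      have le: "2 ^ q \<le> 2 * a + 1"
        using True bit_index_less_nat[of "2 * a + 1" q q] by (auto simp: q_def not_less[symmetric])
      have Xe: "X = (i - 1) * 2 ^ (2 * k) + 2 ^ (2 * k) + a"
        using True x by (cases i) (auto simp: X_def)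
      have ar: "Suc (Y + (2 * a + 1 - Q)) = Y + V + a + (a + 2) - V - Q" if "Q \<le> 2 * a + 1" for Y V Q
        using that by arith
      show ?thesis
        unfolding predecessor_def Let_def Xdm q_def[symmetric] q
        using True unfolding q_def[symmetric] by (simp only: ar[where V = "2 ^ (2 * k)", OF le] Xe simp_thms if_True)
    next
      case False
      then show ?thesis by (auto simp: predecessor_def Let_def Xdm)
    qed
    have new: "tables_ok k N f me pr (Suc (X * N + s)) \<tau>'"
      if "arr \<tau>' me = (arr \<tau> me)(X * N + s := of_bool (member k f X s))"
        "arr \<tau>' pr = (arr \<tau> pr)(X * N + s := predecessor k f X s)" for \<tau>' :: store
      using I(2) dm by (auto simp: tables_ok_def that less_Suc_eq)
    show ?case
      unfolding I_def
      apply (rule conjI)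
      subgoal using distinct I by simp
      subgoal unfolding add_Suc_right
        apply (rule new)
        using distinct I r A s
         apply (auto simp: mem prd not_less mult_2)
        done
      done
  qed
  then show "reg (ev (p_fill n al me pr) \<sigma>) 20 = Suc (reg \<sigma> 16) * N"
    "tables_ok k N f me pr (Suc (reg \<sigma> 16) * N) (ev (p_fill n al me pr) \<sigma>)"
    by (simp_all add: I_def N X_def add.commute)
qed

text \<open>Array 5 is read at \<open>f s + k - i\<close> without a range check. Zeros beyond the
  decoded bits make positions above the window count as outside the set.\<close>

definition scratch_ok :: "nat \<Rightarrow> store \<Rightarrow> bool" where
  "scratch_ok k \<sigma> \<longleftrightarrow> (\<forall>p\<ge>2 * k + 1. arr \<sigma> 5 p = 0)"

definition params_ok :: "nat \<Rightarrow> nat \<Rightarrow> (nat \<Rightarrow> nat) \<Rightarrow> nat \<Rightarrow> nat \<Rightarrow> store \<Rightarrow> bool" where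
  "params_ok k N f n al \<sigma> \<longleftrightarrow> reg \<sigma> 2 = k \<and> reg \<sigma> 3 = 2 * k + 1 \<and> reg \<sigma> 4 = 2 ^ (2 * k) \<and>
     reg \<sigma> n = N \<and> (\<forall>s<N. arr \<sigma> al s = f s) \<and> (\<forall>u<2 * k + 1. arr \<sigma> 4 u = 2 ^ u)"

lemma params_ok_cong:
  assumes "\<And>y. y \<in> {2, 3, 4, n} \<Longrightarrow> reg \<sigma> y = reg \<tau> y" "\<And>A. A \<in> {al, 4} \<Longrightarrow> arr \<sigma> A = arr \<tau> A"
  shows "params_ok k N f n al \<sigma> = params_ok k N f n al \<tau>"
  by (simp add: params_ok_def assms)

definition p_states :: "nat \<Rightarrow> nat \<Rightarrow> nat \<Rightarrow> nat \<Rightarrow> prog" where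
  "p_states n al me pr = PFor 12 4 (PAssign 18 (plus1 (Plus (Reg 12) (Reg 12))) ;; p_decode ;;
     p_fill n al me pr ;; PAssign 16 (plus1 (Reg 16)))"

lemma p_states_frame [simp]:
  "wregs (p_states n al me pr) = {12, 13, 14, 16, 18, 19, 20, 25}"
  "warrs (p_states n al me pr) = {5, me, pr}"
  by (auto simp: p_states_def)

lemma p_states:
  fixes n al me pr :: nat and \<sigma> :: store
  assumes distinct: "n \<notin> {12, 13, 14, 16, 18, 19, 20, 25}" "me \<noteq> pr" "me \<notin> {al, 4, 5}"
      "pr \<notin> {al, 4, 5}" "al \<noteq> 5"
    and par: "params_ok k N f n al \<sigma>" and scr: "scratch_ok k \<sigma>" and i: "reg \<sigma> 11 = i"
    and x: "reg \<sigma> 16 = i * 2 ^ (2 * k)"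
    and idx: "reg \<sigma> 20 = reg \<sigma> 16 * N" and old: "tables_ok k N f me pr (reg \<sigma> 20) \<sigma>"
  defines "\<sigma>' \<equiv> ev (p_states n al me pr) \<sigma>"
  shows "scratch_ok k \<sigma>'" "reg \<sigma>' 16 = Suc i * 2 ^ (2 * k)" "reg \<sigma>' 20 = reg \<sigma>' 16 * N"
    "tables_ok k N f me pr (reg \<sigma>' 20) \<sigma>'"
proof -
  define I where "I a \<tau> \<longleftrightarrow> scratch_ok k \<tau> \<and> reg \<tau> 16 = i * 2 ^ (2 * k) + a \<and>
      reg \<tau> 20 = reg \<tau> 16 * N \<and> tables_ok k N f me pr (reg \<tau> 20) \<tau>" for a and \<tau> :: store
  have "I (reg \<sigma> 4) \<sigma>'"
    unfolding p_states_def \<sigma>'_def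
  proof (rule for_invariant, goal_cases)
    case 1
    then show ?case using scr x idx old by (simp add: I_def scratch_ok_def tables_ok_def)
  next
    case (2 a \<tau>)
    note fr = 2(4) and fa = 2(5)
    have a: "a < 2 ^ (2 * k)" "reg \<tau> 12 = a" using 2 par by (auto simp: params_ok_def)
    have I: "scratch_ok k \<tau>" "reg \<tau> 16 = i * 2 ^ (2 * k) + a" "reg \<tau> 20 = reg \<tau> 16 * N"
      "tables_ok k N f me pr (reg \<tau> 20) \<tau>" using 2 by (auto simp: I_def)
    have "params_ok k N f n al \<sigma> = params_ok k N f n al \<tau>"
    proof (rule params_ok_cong)
      show "reg \<sigma> y = reg \<tau> y" if "y \<in> {2, 3, 4, n}" for y
        by (rule fr[symmetric]) (use that distinct in auto)
      show "arr \<sigma> A = arr \<tau> A" if "A \<in> {al, 4}" for A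
        by (rule fa[symmetric]) (use that distinct in auto)
    qed
    then have par: "params_ok k N f n al \<tau>" using par by simp
    have i\<tau>: "reg \<tau> 11 = i" using fr i by simp
    define \<tau>1 where "\<tau>1 = setr 18 (a + a + 1) \<tau>"
    define \<tau>2 where "\<tau>2 = ev p_decode \<tau>1"
    define \<tau>3 where "\<tau>3 = ev (p_fill n al me pr) \<tau>2"
    have bits: "arr \<tau>2 5 p = of_bool (bit (2 * a + 1) p)" for p
      unfolding \<tau>2_def
      by (subst p_decode)
        (use par a I(1) in \<open>auto simp: \<tau>1_def params_ok_def scratch_ok_def mult_2\<close>)
    have same: "reg \<tau>2 y = reg \<tau> y" if "y \<notin> {13, 18, 19}" for y
      using that by (simp add: \<tau>2_def \<tau>1_def)
    have same_arr: "arr \<tau>2 A = arr \<tau> A" if "A \<noteq> 5" for A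
      using that by (simp add: \<tau>2_def \<tau>1_def)
    have "tables_ok k N f me pr (reg \<tau>2 20) \<tau>2"
      using I(4) distinct by (simp add: same same_arr tables_ok_def)
    moreover have al2: "arr \<tau>2 al s = f s" if "s < N" for s
      using par distinct that by (simp add: same_arr params_ok_def)
    moreover have "reg \<tau>2 n = N" using par distinct by (simp add: same params_ok_def)
    ultimately have fill: "reg \<tau>3 20 = Suc (reg \<tau> 16) * N"
        "tables_ok k N f me pr (Suc (reg \<tau> 16) * N) \<tau>3"
      using p_fill[of n me pr al \<tau>2 k i a N f] distinct par a I i\<tau> bits
      by (auto simp: same same_arr params_ok_def \<tau>3_def)
    have "scratch_ok k \<tau>3"
      using distinct bits bit_index_less_nat[of "2 * a + 1" _ "2 * k + 1"] a
      by (fastforce simp: scratch_ok_def \<tau>3_def)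
    moreover have "reg \<tau>3 16 = reg \<tau> 16" by (simp add: \<tau>3_def same)
    ultimately have "I (Suc a) (setr 12 (Suc a) (setr 16 (reg \<tau>3 16 + 1) \<tau>3))"
      using fill I(2) by (simp add: I_def scratch_ok_def tables_ok_def)
    then show ?case
      using a by (simp add: \<tau>1_def \<tau>2_def \<tau>3_def)
  qed
  moreover have "reg \<sigma> 4 = 2 ^ (2 * k)" using par by (simp add: params_ok_def)
  ultimately have *: "I (2 ^ (2 * k)) \<sigma>'" by simp
  then show "scratch_ok k \<sigma>'" "reg \<sigma>' 20 = reg \<sigma>' 16 * N"
    "tables_ok k N f me pr (reg \<sigma>' 20) \<sigma>'" unfolding I_def by blast+
  from * show "reg \<sigma>' 16 = Suc i * 2 ^ (2 * k)" by (simp add: I_def)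
qed

definition p_build :: "nat \<Rightarrow> nat \<Rightarrow> nat \<Rightarrow> nat \<Rightarrow> nat \<Rightarrow> prog" where
  "p_build n n1 al me pr = PAssign 16 (Const 0) ;; PAssign 20 (Const 0) ;;
     PFor 11 n1 (p_states n al me pr)"

lemma p_build_frame [simp]:
  "wregs (p_build n n1 al me pr) = {11, 12, 13, 14, 16, 18, 19, 20, 25}"
  "warrs (p_build n n1 al me pr) = {5, me, pr}"
  by (auto simp: p_build_def)

lemma p_build:
  fixes n n1 al me pr :: nat and \<sigma> :: store
  assumes distinct: "n \<notin> {11, 12, 13, 14, 16, 18, 19, 20, 25}" "n1 \<notin> {16, 20}" "me \<noteq> pr"
      "me \<notin> {al, 4, 5}" "pr \<notin> {al, 4, 5}" "al \<noteq> 5"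
    and par: "params_ok k N f n al \<sigma>" and scr: "scratch_ok k \<sigma>" and n1: "reg \<sigma> n1 = Suc N"
  defines "\<sigma>' \<equiv> ev (p_build n n1 al me pr) \<sigma>"
  shows "scratch_ok k \<sigma>'" "reg \<sigma>' 16 = Suc N * 2 ^ (2 * k)"
    "tables_ok k N f me pr (Suc N * 2 ^ (2 * k) * N) \<sigma>'"
proof -
  define I where "I i \<tau> \<longleftrightarrow> scratch_ok k \<tau> \<and> reg \<tau> 16 = i * 2 ^ (2 * k) \<and>
      reg \<tau> 20 = reg \<tau> 16 * N \<and> tables_ok k N f me pr (reg \<tau> 20) \<tau>" for i and \<tau> :: store
  define \<sigma>0 where "\<sigma>0 = setr 20 0 (setr 16 0 \<sigma>)"
  have "I (reg \<sigma>0 n1) (ev (PFor 11 n1 (p_states n al me pr)) \<sigma>0)"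
  proof (rule for_invariant, goal_cases)
    case 1
    then show ?case using scr by (simp add: I_def scratch_ok_def tables_ok_def \<sigma>0_def)
  next
    case (2 i \<tau>)
    note fr = 2(4) and fa = 2(5)
    have "params_ok k N f n al \<tau> = params_ok k N f n al \<sigma>0"
      by (rule params_ok_cong; (rule fr | rule fa)) (use distinct in auto)
    also have "\<dots> = params_ok k N f n al \<sigma>"
      by (rule params_ok_cong) (use distinct in \<open>auto simp: \<sigma>0_def\<close>)
    finally have "params_ok k N f n al \<tau>" using par by simp
    then have "I (Suc i) (ev (p_states n al me pr) \<tau>)"
      using p_states[of n me pr al k N f \<tau> i] distinct 2 by (auto simp: I_def)
    then show ?case by (simp add: I_def scratch_ok_def tables_ok_def)
  qed
  moreover have "ev (PFor 11 n1 (p_states n al me pr)) \<sigma>0 = \<sigma>'" "reg \<sigma>0 n1 = Suc N"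
    using distinct n1 by (simp_all add: \<sigma>'_def p_build_def \<sigma>0_def)
  ultimately have "I (Suc N) \<sigma>'" by (simp only:)
  then show "scratch_ok k \<sigma>'" "reg \<sigma>' 16 = Suc N * 2 ^ (2 * k)"
    "tables_ok k N f me pr (Suc N * 2 ^ (2 * k) * N) \<sigma>'" unfolding I_def by metis+
qed

section \<open>Costs\<close>

definition p_setup :: prog where
  "p_setup = PAssign 3 (plus1 (Plus (Reg 2) (Reg 2))) ;; PAssign 32 (Const 1) ;;
     PAssign 6 (plus1 (Reg 0)) ;; PAssign 7 (plus1 (Reg 1)) ;; PAssign 10 (Plus (Reg 0) (Reg 1))"

definition p_powers :: prog where
  "p_powers = PFor 13 3 (PStore 4 (Reg 13) (Reg 32) ;; PAssign 32 (Plus (Reg 32) (Reg 32))) ;;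
     PAssign 4 (Arr 4 (Plus (Reg 2) (Reg 2))) ;; PAssign 5 (Minus (Arr 4 (Reg 2)) (Const 1))"

lemma p_setup_frame [simp]: "wregs p_setup = {3, 6, 7, 10, 32}" "warrs p_setup = {}"
  by (auto simp: p_setup_def)

lemma p_powers_frame [simp]: "wregs p_powers = {4, 5, 13, 32}" "warrs p_powers = {4}"
  by (auto simp: p_powers_def)

lemma p_powers:
  assumes "reg \<sigma> 2 = k" "reg \<sigma> 3 = 2 * k + 1" "reg \<sigma> 32 = 1"
  shows "\<And>u. u < 2 * k + 1 \<Longrightarrow> arr (ev p_powers \<sigma>) 4 u = 2 ^ u"
    "reg (ev p_powers \<sigma>) 4 = 2 ^ (2 * k)" "reg (ev p_powers \<sigma>) 5 = 2 ^ k - 1"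
proof -
  let ?body = "PStore 4 (Reg 13) (Reg 32) ;; PAssign 32 (Plus (Reg 32) (Reg 32))"
  define I where "I t \<tau> \<longleftrightarrow> reg \<tau> 32 = 2 ^ t \<and> (\<forall>u<t. arr \<tau> 4 u = 2 ^ u)" for t and \<tau> :: store
  define \<sigma>' where "\<sigma>' = ev (PFor 13 3 ?body) \<sigma>"
  have "I (reg \<sigma> 3) \<sigma>'"
    unfolding \<sigma>'_def by (rule for_invariant) (auto simp: I_def assms less_Suc_eq)
  then have *: "arr \<sigma>' 4 u = 2 ^ u" if "u < 2 * k + 1" for u
    using that by (simp add: I_def assms)
  have "reg \<sigma>' 2 = k" unfolding \<sigma>'_def using assms by (subst reg_ev) auto
  moreover have "ev p_powers \<sigma> = setr 5 (arr \<sigma>' 4 (reg \<sigma>' 2) - 1) (setr 4 (arr \<sigma>' 4 (reg \<sigma>' 2 + reg \<sigma>' 2)) \<sigma>')"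
    by (simp add: p_powers_def \<sigma>'_def del: ev.simps(6))
  ultimately show "\<And>u. u < 2 * k + 1 \<Longrightarrow> arr (ev p_powers \<sigma>) 4 u = 2 ^ u"
    "reg (ev p_powers \<sigma>) 4 = 2 ^ (2 * k)" "reg (ev p_powers \<sigma>) 5 = 2 ^ k - 1"
    using * by (auto simp: mult_2)
qed

section \<open>Mismatches between a student and a question state\<close>

definition mismatches :: "(nat \<Rightarrow> nat) \<Rightarrow> (nat \<Rightarrow> nat) \<Rightarrow> nat \<Rightarrow> nat \<Rightarrow> nat \<Rightarrow> nat \<Rightarrow> nat" where
  "mismatches e b r s y n = card {q. q < n \<and> e (s * r + q) \<noteq> b (y * r + q)}"

lemma mismatches_0 [simp]: "mismatches e b r s y 0 = 0"
  by (simp add: mismatches_def)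

lemma mismatches_Suc [simp]:
  "mismatches e b r s y (Suc n) =
    mismatches e b r s y n + of_bool (e (s * r + n) \<noteq> b (y * r + n))"
proof -
  have "{q. q < Suc n \<and> e (s * r + q) \<noteq> b (y * r + q)} =
      (if e (s * r + n) \<noteq> b (y * r + n) then insert n else id)
        {q. q < n \<and> e (s * r + q) \<noteq> b (y * r + q)}"
    by (auto simp: less_Suc_eq)
  then show ?thesis by (simp add: mismatches_def)
qed

definition p_count :: prog where
  "p_count = PFor 15 1 (
     PIf (Equal (Arr 2 (Reg 30)) (Arr 8 (Plus (Reg 23) (Reg 15)))) PSkip (PAssign 31 (plus1 (Reg 31))) ;;
     PAssign 30 (plus1 (Reg 30)))"

lemma p_count_frame [simp]: "wregs p_count = {15, 30, 31}" "warrs p_count = {}"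
  by (auto simp: p_count_def)

lemma p_count:
  assumes "reg \<sigma> 1 = r" "reg \<sigma> 23 = y * r" "reg \<sigma> 30 = s * r" "reg \<sigma> 31 = 0"
  shows "reg (ev p_count \<sigma>) 30 = Suc s * r"
    "reg (ev p_count \<sigma>) 31 = mismatches (arr \<sigma> 2) (arr \<sigma> 8) r s y r"
proof -
  define I where "I q \<tau> \<longleftrightarrow> reg \<tau> 30 = s * r + q \<and>
    reg \<tau> 31 = mismatches (arr \<sigma> 2) (arr \<sigma> 8) r s y q" for q and \<tau> :: store
  have "I (reg \<sigma> 1) (ev p_count \<sigma>)"
    unfolding p_count_def by (rule for_invariant) (auto simp: I_def assms)
  then show "reg (ev p_count \<sigma>) 30 = Suc s * r"
    "reg (ev p_count \<sigma>) 31 = mismatches (arr \<sigma> 2) (arr \<sigma> 8) r s y r"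
    unfolding assms(1) by (simp_all add: I_def)
qed

definition p_cost_row :: prog where
  "p_cost_row = PFor 14 0 (PAssign 31 (Const 0) ;; p_count ;; PStore 10 (Reg 20) (Reg 31) ;;
     PAssign 20 (plus1 (Reg 20)))"

lemma p_cost_row_frame [simp]: "wregs p_cost_row = {14, 15, 20, 30, 31}" "warrs p_cost_row = {10}"
  by (auto simp: p_cost_row_def)

definition costs_ok :: "nat \<Rightarrow> nat \<Rightarrow> nat \<Rightarrow> store \<Rightarrow> bool" where
  "costs_ok m r N \<sigma> \<longleftrightarrow>
     (\<forall>j<N. arr \<sigma> 10 j = mismatches (arr \<sigma> 2) (arr \<sigma> 8) r (j mod m) (j div m) r)"

lemma p_cost_row:
  assumes "reg \<sigma> 0 = m" "reg \<sigma> 1 = r" "reg \<sigma> 23 = y * r" "reg \<sigma> 30 = 0" "reg \<sigma> 20 = y * m"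
    "costs_ok m r (y * m) \<sigma>"
  shows "reg (ev p_cost_row \<sigma>) 20 = Suc y * m" "costs_ok m r (Suc y * m) (ev p_cost_row \<sigma>)"
proof -
  define I where "I s \<tau> \<longleftrightarrow> reg \<tau> 30 = s * r \<and> reg \<tau> 20 = y * m + s \<and> costs_ok m r (y * m + s) \<tau>"
    for s and \<tau> :: store
  have "I (reg \<sigma> 0) (ev p_cost_row \<sigma>)"
    unfolding p_cost_row_def
  proof (rule for_invariant, goal_cases)
    case 1
    show ?case using assms by (simp add: I_def costs_ok_def)
  next
    case (2 s \<tau>)
    note fr = 2(4) and fa = 2(5)
    define \<tau>' where "\<tau>' = ev p_count (setr 31 0 \<tau>)"
    have s: "s < m" "reg \<tau> 14 = s" using 2 assms by auto
    have I: "reg \<tau> 30 = s * r" "reg \<tau> 20 = y * m + s" "costs_ok m r (y * m + s) \<tau>"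
      using 2 by (auto simp: I_def)
    have "reg \<tau>' 30 = Suc s * r" "reg \<tau>' 31 = mismatches (arr \<tau> 2) (arr \<tau> 8) r s y r"
      using p_count[of "setr 31 0 \<tau>" r y s] fr assms I by (simp_all add: \<tau>'_def)
    moreover have "arr \<tau>' = arr \<tau>" by (rule ext) (simp add: \<tau>'_def)
    moreover have "reg \<tau>' 20 = y * m + s" using I by (simp add: \<tau>'_def)
    ultimately show ?case
      using I s by (auto simp: I_def costs_ok_def less_Suc_eq simp flip: \<tau>'_def)
  qed
  then show "reg (ev p_cost_row \<sigma>) 20 = Suc y * m" "costs_ok m r (Suc y * m) (ev p_cost_row \<sigma>)"
    using assms by (simp_all add: I_def add.commute)
qed

text \<open>Array 17 is filled here because the output stage meets question states in no particular
  order and could not compute their row offsets without multiplication.\<close>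

definition p_cost :: prog where
  "p_cost = PAssign 20 (Const 0) ;; PAssign 23 (Const 0) ;; PFor 17 9 (
     PStore 17 (Reg 17) (Reg 23) ;; PAssign 30 (Const 0) ;; p_cost_row ;;
     PAssign 23 (Plus (Reg 23) (Reg 1)))"

lemma p_cost_frame [simp]:
  "wregs p_cost = {14, 15, 17, 20, 23, 30, 31}" "warrs p_cost = {10, 17}"
  by (auto simp: p_cost_def)

lemma p_cost:
  assumes "reg \<sigma> 0 = m" "reg \<sigma> 1 = r" "reg \<sigma> 9 = N"
  shows "costs_ok m r (N * m) (ev p_cost \<sigma>)" "\<And>y. y < N \<Longrightarrow> arr (ev p_cost \<sigma>) 17 y = y * r"
proof -
  define I where "I y \<tau> \<longleftrightarrow> reg \<tau> 20 = y * m \<and> reg \<tau> 23 = y * r \<and> costs_ok m r (y * m) \<tau> \<and>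
     (\<forall>y'<y. arr \<tau> 17 y' = y' * r)" for y and \<tau> :: store
  define \<sigma>0 where "\<sigma>0 = setr 23 0 (setr 20 0 \<sigma>)"
  let ?body = "PStore 17 (Reg 17) (Reg 23) ;; PAssign 30 (Const 0) ;; p_cost_row ;;
     PAssign 23 (Plus (Reg 23) (Reg 1))"
  have "I (reg \<sigma>0 9) (ev (PFor 17 9 ?body) \<sigma>0)"
  proof (rule for_invariant, goal_cases)
    case 1
    show ?case using assms by (simp add: I_def costs_ok_def \<sigma>0_def)
  next
    case (2 y \<tau>)
    note fr = 2(4) and fa = 2(5)
    define \<tau>' where "\<tau>' = setr 30 0 (seta 17 y (y * r) \<tau>)"
    have y: "reg \<tau> 17 = y" and I: "reg \<tau> 20 = y * m" "reg \<tau> 23 = y * r" "costs_ok m r (y * m) \<tau>"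
      "\<And>y'. y' < y \<Longrightarrow> arr \<tau> 17 y' = y' * r"
      using 2 by (auto simp: I_def)
    have r: "reg \<tau> 0 = m" "reg \<tau> 1 = r" using fr assms by (simp_all add: \<sigma>0_def)
    have "costs_ok m r (y * m) \<tau>'" using I by (simp add: \<tau>'_def costs_ok_def)
    then have "reg (ev p_cost_row \<tau>') 20 = Suc y * m" "costs_ok m r (Suc y * m) (ev p_cost_row \<tau>')"
      using p_cost_row[of \<tau>' m r y] r I by (simp_all add: \<tau>'_def)
    then have "I (Suc y) (setr 17 (Suc y) (setr 23 (y * r + r) (ev p_cost_row \<tau>')))"
      using I(4) by (auto simp: I_def costs_ok_def less_Suc_eq \<tau>'_def)
    then show ?case using y r I by (simp add: \<tau>'_def)
  qed
  moreover have "reg \<sigma>0 9 = N" "ev (PFor 17 9 ?body) \<sigma>0 = ev p_cost \<sigma>"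
    using assms by (simp_all add: \<sigma>0_def p_cost_def)
  ultimately have "I N (ev p_cost \<sigma>)" by (simp only:)
  then show "costs_ok m r (N * m) (ev p_cost \<sigma>)" "\<And>y. y < N \<Longrightarrow> arr (ev p_cost \<sigma>) 17 y = y * r"
    by (auto simp: I_def)
qed

section \<open>Dynamic programming\<close>

type_synonym cell = "nat \<times> nat \<times> nat \<times> nat"

definition cell :: "store \<Rightarrow> nat \<Rightarrow> cell" where
  "cell \<sigma> j = (arr \<sigma> 12 j, arr \<sigma> 13 j, arr \<sigma> 14 j, arr \<sigma> 15 j)"

text \<open>Requiring the entry itself to be a candidate keeps the parent fields consistent with the
  minimum; the backward walk relies on this. All candidates have positive value, so 0 is free to
  mean that there is none.\<close>

definition cell_ok :: "cell set \<Rightarrow> cell \<Rightarrow> bool" where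
  "cell_ok C c \<longleftrightarrow> (if C = {} then fst c = 0 else c \<in> C \<and> fst c \<noteq> 0 \<and> (\<forall>c'\<in>C. fst c \<le> fst c'))"

definition p_relax :: prog where
  "p_relax = PIf (Conj (Less (Const 0) (Arr 12 (Reg 19)))
       (Neg (Conj (Less (Const 0) (Arr 12 (Reg 24)))
          (Neg (Less (Plus (Arr 12 (Reg 19)) (Reg 26)) (Arr 12 (Reg 24)))))))
     (PStore 12 (Reg 24) (Plus (Arr 12 (Reg 19)) (Reg 26)) ;; PStore 13 (Reg 24) (Reg 27) ;;
      PStore 14 (Reg 24) (Reg 28) ;; PStore 15 (Reg 24) (Reg 29))
     PSkip"

lemma p_relax_frame [simp]: "wregs p_relax = {}" "warrs p_relax = {12, 13, 14, 15}"
  by (auto simp: p_relax_def)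

lemma p_relax:
  assumes "cell_ok C (cell \<sigma> (reg \<sigma> 24))"
  shows "cell_ok (C \<union> (if arr \<sigma> 12 (reg \<sigma> 19) = 0 then {}
      else {(arr \<sigma> 12 (reg \<sigma> 19) + reg \<sigma> 26, reg \<sigma> 27, reg \<sigma> 28, reg \<sigma> 29)})) (cell (ev p_relax \<sigma>) (reg \<sigma> 24))"
    "\<And>j. j \<noteq> reg \<sigma> 24 \<Longrightarrow> cell (ev p_relax \<sigma>) j = cell \<sigma> j"
  using assms by (auto simp: cell_ok_def cell_def p_relax_def split: if_splits)

definition p_relax_students :: prog where
  "p_relax_students = PFor 14 0 (PAssign 25 (Arr 7 (Plus (Reg 21) (Reg 14))) ;;
     PIf (Less (Const 0) (Reg 25))
       (PAssign 19 (Plus (Arr 11 (Minus (Reg 25) (Const 1))) (Reg 17)) ;;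
        PAssign 26 (Arr 10 (Plus (Reg 22) (Reg 14))) ;; PAssign 27 (Minus (Reg 25) (Const 1)) ;;
        PAssign 28 (Reg 17) ;; PAssign 29 (plus1 (Reg 14)) ;; p_relax)
       PSkip)"

definition p_relax_questions :: prog where
  "p_relax_questions = PFor 15 1 (PAssign 25 (Arr 9 (Plus (Reg 23) (Reg 15))) ;;
     PIf (Less (Const 0) (Reg 25))
       (PAssign 19 (Plus (Arr 11 (Reg 16)) (Minus (Reg 25) (Const 1))) ;;
        PAssign 26 (Const 0) ;; PAssign 27 (Reg 16) ;;
        PAssign 28 (Minus (Reg 25) (Const 1)) ;; PAssign 29 (Const 0) ;; p_relax)
       PSkip)"

lemma p_relax_students_frame [simp]:
  "wregs p_relax_students = {14, 19, 25, 26, 27, 28, 29}"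
  "warrs p_relax_students = {12, 13, 14, 15}"
  by (auto simp: p_relax_students_def)

lemma p_relax_questions_frame [simp]:
  "wregs p_relax_questions = {15, 19, 25, 26, 27, 28, 29}"
  "warrs p_relax_questions = {12, 13, 14, 15}"
  by (auto simp: p_relax_questions_def)

definition p_cell :: prog where
  "p_cell = PIf (Conj (Equal (Reg 16) (Reg 5)) (Equal (Reg 17) (Reg 5)))
       (PStore 12 (Reg 24) (Const 1)) (PStore 12 (Reg 24) (Const 0)) ;;
     p_relax_students ;; p_relax_questions ;; PAssign 24 (plus1 (Reg 24)) ;;
     PAssign 22 (Plus (Reg 22) (Reg 0)) ;; PAssign 23 (Plus (Reg 23) (Reg 1))"

lemma p_cell_frame [simp]:
  "wregs p_cell = {14, 15, 19, 22, 23, 24, 25, 26, 27, 28, 29}" "warrs p_cell = {12, 13, 14, 15}"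
  by (auto simp: p_cell_def)

definition p_dp_row :: prog where
  "p_dp_row = PFor 17 9 p_cell"

lemma p_dp_row_frame [simp]:
  "wregs p_dp_row = {14, 15, 17, 19, 22, 23, 24, 25, 26, 27, 28, 29}" "warrs p_dp_row = {12, 13, 14, 15}"
  by (auto simp: p_dp_row_def)

definition p_dp :: prog where
  "p_dp = PAssign 21 (Const 0) ;; PAssign 24 (Const 0) ;; PFor 16 8 (
     PStore 11 (Reg 16) (Reg 24) ;; PAssign 22 (Const 0) ;; PAssign 23 (Const 0) ;; p_dp_row ;;
     PAssign 21 (Plus (Reg 21) (Reg 0)))"

lemma p_dp_frame [simp]:
  "wregs p_dp = {14, 15, 16, 17, 19, 21, 22, 23, 24, 25, 26, 27, 28, 29}"
  "warrs p_dp = {11, 12, 13, 14, 15}"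
  by (auto simp: p_dp_def)

text \<open>Filling the table row by row only needs predecessors to be smaller than their
  successors. What the three input tables mean enters later, in the proof of optimality.\<close>

locale dp_tables =
  fixes m r NX NY S0 :: nat and PS PQ CO :: "nat \<Rightarrow> nat"
  assumes PS_less: "\<And>x s x'. x < NX \<Longrightarrow> s < m \<Longrightarrow> PS (x * m + s) = Suc x' \<Longrightarrow> x' < x"
    and PQ_less: "\<And>y q y'. y < NY \<Longrightarrow> q < r \<Longrightarrow> PQ (y * r + q) = Suc y' \<Longrightarrow> y' < y"
begin

definition loaded :: "store \<Rightarrow> bool" where
  "loaded \<sigma> \<longleftrightarrow> reg \<sigma> 0 = m \<and> reg \<sigma> 1 = r \<and> reg \<sigma> 5 = S0 \<and> reg \<sigma> 8 = NX \<and> reg \<sigma> 9 = NY \<and>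
     arr \<sigma> 7 = PS \<and> arr \<sigma> 9 = PQ \<and> arr \<sigma> 10 = CO"

lemma loaded_cong:
  assumes "\<And>y. y \<in> {0, 1, 5, 8, 9} \<Longrightarrow> reg \<sigma> y = reg \<tau> y" "\<And>A. A \<in> {7, 9, 10} \<Longrightarrow> arr \<sigma> A = arr \<tau> A"
  shows "loaded \<sigma> = loaded \<tau>"
  using assms(1)[of 1] by (simp add: loaded_def assms)

definition student_cands :: "(nat \<Rightarrow> nat) \<Rightarrow> nat \<Rightarrow> nat \<Rightarrow> nat \<Rightarrow> cell set" where
  "student_cands D x y n = {(D (x' * NY + y) + CO (y * m + s), x', y, Suc s) | s x'.
     s < n \<and> PS (x * m + s) = Suc x' \<and> D (x' * NY + y) \<noteq> 0}"

definition question_cands :: "(nat \<Rightarrow> nat) \<Rightarrow> nat \<Rightarrow> nat \<Rightarrow> nat \<Rightarrow> cell set" where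
  "question_cands D x y n = {(D (x * NY + y'), x, y', 0) | q y'.
     q < n \<and> PQ (y * r + q) = Suc y' \<and> D (x * NY + y') \<noteq> 0}"

text \<open>The parent entries of the start cell are never read, hence arbitrary.\<close>

definition start_cands :: "nat \<Rightarrow> nat \<Rightarrow> cell set" where
  "start_cands x y = (if x = S0 \<and> y = S0 then {1} \<times> UNIV else {})"

definition cands :: "(nat \<Rightarrow> nat) \<Rightarrow> nat \<Rightarrow> nat \<Rightarrow> cell set" where
  "cands D x y = start_cands x y \<union> student_cands D x y m \<union> question_cands D x y r"

lemma student_cands_Suc:
  "student_cands D x y (Suc s) = student_cands D x y s \<union>
    (case PS (x * m + s) of 0 \<Rightarrow> {} | Suc x' \<Rightarrow> if D (x' * NY + y) = 0 then {}
       else {(D (x' * NY + y) + CO (y * m + s), x', y, Suc s)})"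
  by (auto simp: student_cands_def less_Suc_eq split: nat.splits)

lemma question_cands_Suc:
  "question_cands D x y (Suc q) = question_cands D x y q \<union>
    (case PQ (y * r + q) of 0 \<Rightarrow> {} | Suc y' \<Rightarrow> if D (x * NY + y') = 0 then {}
       else {(D (x * NY + y'), x, y', 0)})"
  by (auto simp: question_cands_def less_Suc_eq split: nat.splits)

lemma p_relax_students:
  assumes l: "loaded \<sigma>" and x: "reg \<sigma> 16 = x" "x < NX" and y: "reg \<sigma> 17 = y" "y < NY"
    and "reg \<sigma> 21 = x * m" "reg \<sigma> 22 = y * m" and cur: "reg \<sigma> 24 = x * NY + y"
    and rows: "\<And>x'. x' \<le> x \<Longrightarrow> arr \<sigma> 11 x' = x' * NY"
    and c: "cell_ok C (cell \<sigma> (x * NY + y))"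
  shows "cell_ok (C \<union> student_cands (arr \<sigma> 12) x y m) (cell (ev p_relax_students \<sigma>) (x * NY + y))"
    "\<And>j. j \<noteq> x * NY + y \<Longrightarrow> cell (ev p_relax_students \<sigma>) j = cell \<sigma> j"
proof -
  define J where "J = x * NY + y"
  define I where "I s \<tau> \<longleftrightarrow> cell_ok (C \<union> student_cands (arr \<sigma> 12) x y s) (cell \<tau> J) \<and>
    (\<forall>j. j \<noteq> J \<longrightarrow> cell \<tau> j = cell \<sigma> j)" for s and \<tau> :: store
  have "I (reg \<sigma> 0) (ev p_relax_students \<sigma>)"
    unfolding p_relax_students_def
  proof (rule for_invariant, goal_cases)
    case 1
    show ?case using c by (simp add: I_def student_cands_def cell_def J_def)
  next
    case (2 s \<tau>)
    note fr = 2(4) and fa = 2(5)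
    have s: "s < m" "reg \<tau> 14 = s" using 2 l by (auto simp: loaded_def)
    have I: "cell_ok (C \<union> student_cands (arr \<sigma> 12) x y s) (cell \<tau> J)"
      "\<And>j. j \<noteq> J \<Longrightarrow> cell \<tau> j = cell \<sigma> j" using 2(2) by (auto simp: I_def)
    have r: "reg \<tau> 17 = y" "reg \<tau> 21 = x * m" "reg \<tau> 22 = y * m" "reg \<tau> 24 = J"
      using fr assms by (simp_all add: J_def)
    have a: "arr \<tau> 7 = PS" "arr \<tau> 10 = CO" "arr \<tau> 11 = arr \<sigma> 11"
      using fa l by (simp_all add: loaded_def)
    show ?case
    proof (cases "PS (x * m + s)")
      case 0
      then show ?thesis using I r a s by (simp add: I_def student_cands_Suc cell_def)
    next
      case (Suc x')
      define \<tau>' where "\<tau>' = setr 29 (Suc s) (setr 28 y (setr 27 x' (setr 26 (CO (y * m + s))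
        (setr 19 (x' * NY + y) (setr 25 (Suc x') \<tau>)))))"
      have "x' < x" using PS_less x s Suc by blast
      then have u: "arr \<sigma> 11 x' = x' * NY" "x' * NY + y \<noteq> J" using rows y(2) by (auto simp: J_def)
      have "arr \<tau>' 12 (x' * NY + y) = arr \<sigma> 12 (x' * NY + y)"
        using I(2)[OF u(2)] by (simp add: cell_def \<tau>'_def)
      moreover have "cell \<tau>' = cell \<tau>" by (rule ext) (simp add: cell_def \<tau>'_def)
      ultimately have "I (Suc s) (ev p_relax \<tau>')"
        using p_relax[of "C \<union> student_cands (arr \<sigma> 12) x y s" \<tau>'] I r Suc
        by (auto simp: I_def student_cands_Suc \<tau>'_def Un_assoc)
      then have "I (Suc s) (setr 14 (Suc s) (ev p_relax \<tau>'))" by (simp add: I_def cell_def)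
      then show ?thesis using Suc r a s u by (simp add: \<tau>'_def)
    qed
  qed
  then show "cell_ok (C \<union> student_cands (arr \<sigma> 12) x y m) (cell (ev p_relax_students \<sigma>) (x * NY + y))"
    "\<And>j. j \<noteq> x * NY + y \<Longrightarrow> cell (ev p_relax_students \<sigma>) j = cell \<sigma> j"
    using l by (auto simp: I_def loaded_def J_def)
qed

lemma p_relax_questions:
  assumes l: "loaded \<sigma>" and x: "reg \<sigma> 16 = x" "x < NX" and y: "reg \<sigma> 17 = y" "y < NY"
    and "reg \<sigma> 23 = y * r" and cur: "reg \<sigma> 24 = x * NY + y"
    and rows: "\<And>x'. x' \<le> x \<Longrightarrow> arr \<sigma> 11 x' = x' * NY"
    and c: "cell_ok C (cell \<sigma> (x * NY + y))"
  shows "cell_ok (C \<union> question_cands (arr \<sigma> 12) x y r) (cell (ev p_relax_questions \<sigma>) (x * NY + y))"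
    "\<And>j. j \<noteq> x * NY + y \<Longrightarrow> cell (ev p_relax_questions \<sigma>) j = cell \<sigma> j"
proof -
  define J where "J = x * NY + y"
  define I where "I q \<tau> \<longleftrightarrow> cell_ok (C \<union> question_cands (arr \<sigma> 12) x y q) (cell \<tau> J) \<and>
    (\<forall>j. j \<noteq> J \<longrightarrow> cell \<tau> j = cell \<sigma> j)" for q and \<tau> :: store
  have "I (reg \<sigma> 1) (ev p_relax_questions \<sigma>)"
    unfolding p_relax_questions_def
  proof (rule for_invariant, goal_cases)
    case 1
    show ?case using c by (simp add: I_def question_cands_def cell_def J_def)
  next
    case (2 q \<tau>)
    note fr = 2(4) and fa = 2(5)
    have q: "q < r" "reg \<tau> 15 = q" using 2 l by (auto simp: loaded_def)
    have I: "cell_ok (C \<union> question_cands (arr \<sigma> 12) x y q) (cell \<tau> J)"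
      "\<And>j. j \<noteq> J \<Longrightarrow> cell \<tau> j = cell \<sigma> j" using 2(2) by (auto simp: I_def)
    have r: "reg \<tau> 16 = x" "reg \<tau> 23 = y * r" "reg \<tau> 24 = J"
      using fr assms by (simp_all add: J_def)
    have a: "arr \<tau> 9 = PQ" "arr \<tau> 11 x = x * NY"
      using fa l rows by (simp_all add: loaded_def)
    show ?case
    proof (cases "PQ (y * r + q)")
      case 0
      then show ?thesis using I r a q by (simp add: I_def question_cands_Suc cell_def)
    next
      case (Suc y')
      define \<tau>' where "\<tau>' = setr 29 0 (setr 28 y' (setr 27 x (setr 26 0
        (setr 19 (x * NY + y') (setr 25 (Suc y') \<tau>)))))"
      have u: "x * NY + y' \<noteq> J" using PQ_less[OF y(2) q(1) Suc] by (simp add: J_def)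
      have "arr \<tau>' 12 (x * NY + y') = arr \<sigma> 12 (x * NY + y')"
        using I(2)[OF u] by (simp add: cell_def \<tau>'_def)
      moreover have "cell \<tau>' = cell \<tau>" by (rule ext) (simp add: cell_def \<tau>'_def)
      ultimately have "I (Suc q) (ev p_relax \<tau>')"
        using p_relax[of "C \<union> question_cands (arr \<sigma> 12) x y q" \<tau>'] I r Suc
        by (auto simp: I_def question_cands_Suc \<tau>'_def Un_assoc)
      then have "I (Suc q) (setr 15 (Suc q) (ev p_relax \<tau>'))" by (simp add: I_def cell_def)
      then show ?thesis using Suc r a q u by (simp add: \<tau>'_def)
    qed
  qed
  moreover have "reg \<sigma> 1 = r" using l by (simp add: loaded_def)
  ultimately have "I r (ev p_relax_questions \<sigma>)" by (simp only:)
  then show "cell_ok (C \<union> question_cands (arr \<sigma> 12) x y r) (cell (ev p_relax_questions \<sigma>) (x * NY + y))"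
    "\<And>j. j \<noteq> x * NY + y \<Longrightarrow> cell (ev p_relax_questions \<sigma>) j = cell \<sigma> j"
    by (auto simp: I_def J_def)
qed

definition dp_ok :: "nat \<Rightarrow> store \<Rightarrow> bool" where
  "dp_ok N \<sigma> \<longleftrightarrow> (\<forall>x y. y < NY \<and> x * NY + y < N \<longrightarrow> cell_ok (cands (arr \<sigma> 12) x y) (cell \<sigma> (x * NY + y)))"

text \<open>Each transition lowers exactly one coordinate, so candidates of a cell are read from
  cells that precede it in row-major order. Hence an entry that has been verified stays correct
  while later cells are written.\<close>

lemma cands_cong:
  assumes "x < NX" "y < NY" "\<And>j. j < x * NY + y \<Longrightarrow> D j = D' j"
  shows "cands D x y = cands D' x y"
proof -
  have 1: "D (x' * NY + y) = D' (x' * NY + y)" if "s < m" "PS (x * m + s) = Suc x'" for s x'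
    using PS_less[OF assms(1) that] assms(2,3) by simp
  have 2: "D (x * NY + y') = D' (x * NY + y')" if "q < r" "PQ (y * r + q) = Suc y'" for q y'
    using PQ_less[OF assms(2) that] assms(3) by simp
  have "student_cands D x y m = student_cands D' x y m"
    unfolding student_cands_def by (intro Collect_cong ex_cong1) (use 1 in auto)
  moreover have "question_cands D x y r = question_cands D' x y r"
    unfolding question_cands_def by (intro Collect_cong ex_cong1) (use 2 in auto)
  ultimately show ?thesis by (simp add: cands_def)
qed

lemma p_cell:
  assumes l: "loaded \<sigma>" and x: "reg \<sigma> 16 = x" "x < NX" and y: "reg \<sigma> 17 = y" "y < NY"
    and m: "reg \<sigma> 21 = x * m" "reg \<sigma> 22 = y * m" "reg \<sigma> 23 = y * r"
    and cur: "reg \<sigma> 24 = x * NY + y"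
    and rows: "\<And>x'. x' \<le> x \<Longrightarrow> arr \<sigma> 11 x' = x' * NY"
    and ok: "dp_ok (x * NY + y) \<sigma>"
  defines "\<sigma>' \<equiv> ev p_cell \<sigma>"
  shows "reg \<sigma>' 22 = Suc y * m" "reg \<sigma>' 23 = Suc y * r" "reg \<sigma>' 24 = Suc (x * NY + y)"
    "dp_ok (Suc (x * NY + y)) \<sigma>'"
proof -
  define J where "J = x * NY + y"
  define \<sigma>1 where "\<sigma>1 = seta 12 J (of_bool (x = S0 \<and> y = S0)) \<sigma>"
  define \<sigma>2 where "\<sigma>2 = ev p_relax_students \<sigma>1"
  define \<sigma>3 where "\<sigma>3 = ev p_relax_questions \<sigma>2"
  have r: "reg \<sigma> 0 = m" "reg \<sigma> 1 = r" "reg \<sigma> 5 = S0" using l by (auto simp: loaded_def)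
  have \<sigma>': "\<sigma>' = setr 23 (Suc y * r) (setr 22 (Suc y * m) (setr 24 (Suc J) \<sigma>3))"
    using r x(1) y(1) m cur
    by (auto simp: \<sigma>'_def p_cell_def \<sigma>3_def \<sigma>2_def \<sigma>1_def J_def add.commute)
  have c1: "cell_ok (start_cands x y) (cell \<sigma>1 J)"
    by (auto simp: cell_ok_def start_cands_def cell_def \<sigma>1_def)
  have o1: "cell \<sigma>1 j = cell \<sigma> j" if "j \<noteq> J" for j using that by (simp add: cell_def \<sigma>1_def)
  have l1: "loaded \<sigma>1" using l by (simp add: loaded_def \<sigma>1_def)
  have c2: "cell_ok (start_cands x y \<union> student_cands (arr \<sigma>1 12) x y m) (cell \<sigma>2 J)"
    and o2: "\<And>j. j \<noteq> J \<Longrightarrow> cell \<sigma>2 j = cell \<sigma>1 j"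
    using p_relax_students[OF l1, of x y "start_cands x y"] x y m cur rows c1
    by (auto simp: \<sigma>2_def J_def \<sigma>1_def)
  have l2: "loaded \<sigma>2" using l1 by (simp add: loaded_def \<sigma>2_def)
  have c3: "cell_ok (start_cands x y \<union> student_cands (arr \<sigma>1 12) x y m \<union> question_cands (arr \<sigma>2 12) x y r) (cell \<sigma>3 J)"
    and o3: "\<And>j. j \<noteq> J \<Longrightarrow> cell \<sigma>3 j = cell \<sigma>2 j"
    using p_relax_questions[OF l2, of x y "start_cands x y \<union> student_cands (arr \<sigma>1 12) x y m"]
      x y m cur rows c2
    by (auto simp: \<sigma>3_def J_def \<sigma>2_def \<sigma>1_def)
  \<comment> \<open>Only cell \<open>J\<close> changes, and no candidate for \<open>J\<close> reads
    \<open>J\<close>. Candidates formed in the intermediate stores therefore coincide with those of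
    the final store.\<close>
  have D: "arr \<sigma>1 12 j = arr \<sigma>' 12 j" "arr \<sigma>2 12 j = arr \<sigma>' 12 j" "cell \<sigma> j = cell \<sigma>' j" if "j \<noteq> J" for j
    using o1[OF that] o2[OF that] o3[OF that] by (simp_all add: cell_def \<sigma>')
  have "student_cands (arr \<sigma>1 12) x y m = student_cands (arr \<sigma>' 12) x y m"
  proof -
    have "x' * NY + y \<noteq> J" if "s < m" "PS (x * m + s) = Suc x'" for s x'
      using PS_less[OF x(2) that] y(2) by (simp add: J_def)
    then have "arr \<sigma>1 12 (x' * NY + y) = arr \<sigma>' 12 (x' * NY + y)" if "s < m" "PS (x * m + s) = Suc x'" for s x'
      using that D(1) by blast
    then show ?thesis unfolding student_cands_def by (intro Collect_cong ex_cong1) auto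
  qed
  moreover have "question_cands (arr \<sigma>2 12) x y r = question_cands (arr \<sigma>' 12) x y r"
  proof -
    have "x * NY + y' \<noteq> J" if "q < r" "PQ (y * r + q) = Suc y'" for q y'
      using PQ_less[OF y(2) that] by (simp add: J_def)
    then have "arr \<sigma>2 12 (x * NY + y') = arr \<sigma>' 12 (x * NY + y')" if "q < r" "PQ (y * r + q) = Suc y'" for q y'
      using that D(2) by blast
    then show ?thesis unfolding question_cands_def by (intro Collect_cong ex_cong1) auto
  qed
  moreover have "cell \<sigma>3 J = cell \<sigma>' J" by (simp add: cell_def \<sigma>')
  ultimately have new: "cell_ok (cands (arr \<sigma>' 12) x y) (cell \<sigma>' J)"
    using c3 by (simp add: cands_def)
  have "cell_ok (cands (arr \<sigma>' 12) x' y') (cell \<sigma>' (x' * NY + y'))"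
    if "y' < NY" "x' * NY + y' < Suc J" for x' y'
  proof (cases "x' * NY + y' = J")
    case True
    have "(x' * NY + y') div NY = (x * NY + y) div NY" "(x' * NY + y') mod NY = (x * NY + y) mod NY"
      using True by (simp_all add: J_def)
    then have "x' = x" "y' = y" using that y by simp_all
    then show ?thesis using new J_def by simp
  next
    case False
    then have lt: "x' * NY + y' < J" using that by simp
    then have "(x' * NY + y') div NY \<le> (x * NY + y) div NY" unfolding J_def by (intro div_le_mono) simp
    then have "x' < NX" using that y x by simp
    then have "cands (arr \<sigma>' 12) x' y' = cands (arr \<sigma> 12) x' y'"
      by (rule cands_cong) (use that lt D(3) in \<open>auto simp: cell_def\<close>)
    then show ?thesis using ok lt that unfolding dp_ok_def J_def[symmetric] D(3)[OF False, symmetric] by simp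
  qed
  then show "dp_ok (Suc (x * NY + y)) \<sigma>'" by (simp add: dp_ok_def J_def)
  show "reg \<sigma>' 22 = Suc y * m" "reg \<sigma>' 23 = Suc y * r" "reg \<sigma>' 24 = Suc (x * NY + y)"
    by (simp_all add: \<sigma>' J_def)
qed

lemma p_dp_row:
  assumes l: "loaded \<sigma>" and x: "reg \<sigma> 16 = x" "x < NX"
    and m: "reg \<sigma> 21 = x * m" "reg \<sigma> 22 = 0" "reg \<sigma> 23 = 0" and cur: "reg \<sigma> 24 = x * NY"
    and rows: "\<And>x'. x' \<le> x \<Longrightarrow> arr \<sigma> 11 x' = x' * NY"
    and ok: "dp_ok (x * NY) \<sigma>"
  defines "\<sigma>' \<equiv> ev p_dp_row \<sigma>"
  shows "reg \<sigma>' 24 = Suc x * NY" "dp_ok (Suc x * NY) \<sigma>'"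
proof -
  define I where "I y \<tau> \<longleftrightarrow> reg \<tau> 22 = y * m \<and> reg \<tau> 23 = y * r \<and> reg \<tau> 24 = x * NY + y \<and>
    dp_ok (x * NY + y) \<tau>" for y and \<tau> :: store
  have "I (reg \<sigma> 9) \<sigma>'"
    unfolding \<sigma>'_def p_dp_row_def
  proof (rule for_invariant, goal_cases)
    case 1
    show ?case using m cur ok by (simp add: I_def dp_ok_def cell_def)
  next
    case (2 y \<tau>)
    note fr = 2(4) and fa = 2(5)
    have "loaded \<tau> = loaded \<sigma>" by (rule loaded_cong; (rule fr | rule fa)) auto
    then have lt: "loaded \<tau>" using l by simp
    have y: "y < NY" "reg \<tau> 17 = y" using 2 l by (auto simp: loaded_def)
    have I: "reg \<tau> 22 = y * m" "reg \<tau> 23 = y * r" "reg \<tau> 24 = x * NY + y" "dp_ok (x * NY + y) \<tau>"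
      using 2 by (auto simp: I_def)
    have o: "reg \<tau> 16 = x" "reg \<tau> 21 = x * m" "arr \<tau> 11 = arr \<sigma> 11" using fr fa x m by simp_all
    have "I (Suc y) (ev p_cell \<tau>)"
      using p_cell[OF lt, of x y] I o y x rows by (simp add: I_def)
    then show ?case by (simp add: I_def dp_ok_def cell_def)
  qed
  then have "I NY \<sigma>'" using l by (simp add: loaded_def)
  then show "reg \<sigma>' 24 = Suc x * NY" "dp_ok (Suc x * NY) \<sigma>'" by (simp_all add: I_def add.commute)
qed

lemma p_dp:
  assumes l: "loaded \<sigma>"
  shows "dp_ok (NX * NY) (ev p_dp \<sigma>)" "\<And>x. x < NX \<Longrightarrow> arr (ev p_dp \<sigma>) 11 x = x * NY"
proof -
  define I where "I x \<tau> \<longleftrightarrow> reg \<tau> 21 = x * m \<and> reg \<tau> 24 = x * NY \<and> dp_ok (x * NY) \<tau> \<and>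
     (\<forall>x'<x. arr \<tau> 11 x' = x' * NY)" for x and \<tau> :: store
  define \<sigma>0 where "\<sigma>0 = setr 24 0 (setr 21 0 \<sigma>)"
  let ?body = "PStore 11 (Reg 16) (Reg 24) ;; PAssign 22 (Const 0) ;; PAssign 23 (Const 0) ;; p_dp_row ;;
     PAssign 21 (Plus (Reg 21) (Reg 0))"
  have l0: "loaded \<sigma>0" using l by (simp add: loaded_def \<sigma>0_def)
  have "I (reg \<sigma>0 8) (ev (PFor 16 8 ?body) \<sigma>0)"
  proof (rule for_invariant, goal_cases)
    case 1
    show ?case by (simp add: I_def dp_ok_def \<sigma>0_def)
  next
    case (2 x \<tau>)
    note fr = 2(4) and fa = 2(5)
    have "loaded \<tau> = loaded \<sigma>0" by (rule loaded_cong; (rule fr | rule fa)) auto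
    then have lt: "loaded \<tau>" using l0 by simp
    have x: "x < NX" "reg \<tau> 16 = x" using 2 l0 by (auto simp: loaded_def)
    have I: "reg \<tau> 21 = x * m" "reg \<tau> 24 = x * NY" "dp_ok (x * NY) \<tau>"
      "\<And>x'. x' < x \<Longrightarrow> arr \<tau> 11 x' = x' * NY" using 2 by (auto simp: I_def)
    define \<tau>' where "\<tau>' = setr 23 0 (setr 22 0 (seta 11 x (x * NY) \<tau>))"
    have l': "loaded \<tau>'" using lt by (simp add: loaded_def \<tau>'_def)
    have "dp_ok (x * NY) \<tau>'" using I(3) by (simp add: dp_ok_def cell_def \<tau>'_def)
    then have "reg (ev p_dp_row \<tau>') 24 = Suc x * NY" "dp_ok (Suc x * NY) (ev p_dp_row \<tau>')"
      using p_dp_row[OF l', of x] x I by (auto simp: \<tau>'_def)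
    then have "I (Suc x) (setr 16 (Suc x) (setr 21 (x * m + m) (ev p_dp_row \<tau>')))"
      using I(4) by (auto simp: I_def dp_ok_def cell_def less_Suc_eq \<tau>'_def)
    moreover have "reg \<tau> 0 = m" using lt by (simp add: loaded_def)
    ultimately show ?case using x I by (simp add: \<tau>'_def)
  qed
  moreover have "reg \<sigma>0 8 = NX" "ev (PFor 16 8 ?body) \<sigma>0 = ev p_dp \<sigma>"
    using l by (simp_all add: \<sigma>0_def p_dp_def loaded_def)
  ultimately have "I NX (ev p_dp \<sigma>)" by (simp only:)
  then show "dp_ok (NX * NY) (ev p_dp \<sigma>)" "\<And>x. x < NX \<Longrightarrow> arr (ev p_dp \<sigma>) 11 x = x * NY"
    by (auto simp: I_def)
qed

end

section \<open>Optimality\<close>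

locale chain_dp =
  fixes m r k :: nat and \<alpha> \<gamma> :: "nat \<Rightarrow> nat" and E :: "(nat \<times> nat) set"
    and PS PQ CO :: "nat \<Rightarrow> nat"
  assumes inst: "both_near_instance {..<m} {..<r} E \<alpha> \<gamma> k"
    and PS: "\<And>x s. x < Suc m * 2 ^ (2 * k) \<Longrightarrow> s < m \<Longrightarrow> PS (x * m + s) = predecessor k \<alpha> x s"
    and PQ: "\<And>y q. y < Suc r * 2 ^ (2 * k) \<Longrightarrow> q < r \<Longrightarrow> PQ (y * r + q) = predecessor k \<gamma> y q"
    and CO: "\<And>y s. y < Suc r * 2 ^ (2 * k) \<Longrightarrow> s < m \<Longrightarrow>
       CO (y * m + s) = card {q. q < r \<and> ((s, q) \<in> E) \<noteq> member k \<gamma> y q}"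
begin

abbreviation "W \<equiv> (2 :: nat) ^ (2 * k)"

lemma k: "k > 0" and E: "E \<subseteq> {..<m} \<times> {..<r}" and \<alpha>: "ordering_of {..<m} \<alpha>"
  and \<gamma>: "ordering_of {..<r} \<gamma>"
  using inst by (auto simp: both_near_instance_def)

definition NX :: nat where "NX = Suc m * W"
definition NY :: nat where "NY = Suc r * W"
definition S0 :: nat where "S0 = 2 ^ k - 1"

lemma less_NX: "x < NX \<longleftrightarrow> x div W \<le> m" and less_NY: "y < NY \<longleftrightarrow> y div W \<le> r"
  unfolding NX_def NY_def by (simp_all add: div_less_iff_less_mult flip: less_Suc_eq_le)

sublocale dp_tables m r NX NY S0 PS PQ CO
  unfolding NX_def NY_def
  by unfold_locales (metis PS predecessor_less, metis PQ predecessor_less)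

lemmas PS' = PS[folded NX_def] and PQ' = PQ[folded NY_def] and CO' = CO[folded NY_def]

section \<open>Soundness of the backward walk\<close>

definition cost :: "nat \<Rightarrow> nat \<Rightarrow> nat" where
  "cost s y = card {q. q < r \<and> ((s, q) \<in> E) \<noteq> member k \<gamma> y q}"

definition dp_table :: "(nat \<Rightarrow> nat) \<Rightarrow> (nat \<Rightarrow> nat) \<Rightarrow> (nat \<Rightarrow> nat) \<Rightarrow> (nat \<Rightarrow> nat) \<Rightarrow> bool" where
  "dp_table D PX PY ST \<longleftrightarrow> (\<forall>x < NX. \<forall>y < NY. let j = x * NY + y in
     cell_ok (cands D x y) (D j, PX j, PY j, ST j))"

abbreviation idx :: "nat \<Rightarrow> nat \<Rightarrow> nat" where
  "idx x y \<equiv> x * NY + y"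

text \<open>
  The loop invariant of the backward walk from the final cell: \<open>Ls\<close> and \<open>Lq\<close> list the students and
  questions still to be inserted at the cell \<open>(x, y)\<close>, in order, and \<open>Y s\<close> is the question state
  at which \<open>s\<close> is inserted.
\<close>

definition trace :: "(nat \<Rightarrow> nat) \<Rightarrow> nat \<Rightarrow> nat \<Rightarrow> (nat \<Rightarrow> nat) \<Rightarrow> bool" where
  "trace D x y Y \<longleftrightarrow> (\<exists>Ls Lq. tail k \<alpha> m x Ls \<and> tail k \<gamma> r y Lq \<and> D (idx x y) \<noteq> 0 \<and>
     D (idx x y) + (\<Sum>s\<in>set Ls. cost s (Y s)) = D (idx (final_state k m) (final_state k r)) \<and>
     (\<forall>s\<in>set Ls. Y s div W \<le> r \<and> y div W \<le> Y s div W \<and>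
        {q. q < r \<and> \<not> member k \<gamma> (Y s) q} = set (drop (Y s div W - y div W) Lq)) \<and>
     sorted (map (\<lambda>s. Y s div W) Ls))"

lemma trace_final:
  assumes "D (idx (final_state k m) (final_state k r)) \<noteq> 0"
  shows "trace D (final_state k m) (final_state k r) Y"
  unfolding trace_def
  by (intro exI[of _ "[]"]) (use assms in \<open>auto simp: tail_final_state[OF \<alpha>] tail_final_state[OF \<gamma>]\<close>)

lemma trace_bounds:
  assumes "trace D x y Y"
  shows "x < NX" "y < NY" "x div W \<le> m" "y div W \<le> r"
  using assms unfolding trace_def tail_def less_NX less_NY by auto

lemma start_div: "S0 div W = 0"
  using ones_less[of k] by (simp add: S0_def)

text \<open>A student step puts \<open>s\<close> in front of \<open>Ls\<close> with question state
  \<open>y\<close>. All of \<open>Lq\<close> is missing there, so the offset of the suffix is 0, and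
  no recorded count is below that of \<open>y\<close>, so sortedness persists. A question step
  lengthens \<open>Lq\<close> at the front and lowers the count of \<open>y\<close> by one, which
  leaves every recorded suffix as it was. The costs telescope in the first case and do not change in
  the second.\<close>

lemma trace_step:
  assumes tr: "trace D x y Y" and ok: "cell_ok (cands D x y) (D (idx x y), px, py, st)"
    and pos: "x div W + y div W > 0"
  shows "trace D px py (if 0 < st then Y(st - 1 := y) else Y)"
    "Suc (px div W + py div W) = x div W + y div W"
proof -
  obtain Ls Lq where t: "tail k \<alpha> m x Ls" "tail k \<gamma> r y Lq" "D (idx x y) \<noteq> 0"
     "D (idx x y) + (\<Sum>s\<in>set Ls. cost s (Y s)) = D (idx (final_state k m) (final_state k r))"
     "\<And>s. s \<in> set Ls \<Longrightarrow> Y s div W \<le> r \<and> y div W \<le> Y s div W \<and>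
        {q. q < r \<and> \<not> member k \<gamma> (Y s) q} = set (drop (Y s div W - y div W) Lq)"
     "sorted (map (\<lambda>s. Y s div W) Ls)"
    using tr unfolding trace_def by blast
  note b = trace_bounds[OF tr]
  have mem: "(D (idx x y), px, py, st) \<in> cands D x y"
    using ok t(3) by (auto simp: cell_ok_def split: if_splits)
  \<comment> \<open>The parent fields of the start cell are arbitrary, so it has to be excluded
    before they are followed; its counts are both 0.\<close>
  have nostart: "(D (idx x y), px, py, st) \<notin> start_cands x y"
    using pos start_div by (auto simp: start_cands_def)
  consider
      (student) s where "s < m" "predecessor k \<alpha> x s = Suc px" "D (idx px y) \<noteq> 0" "st = Suc s" "py = y"
        "D (idx x y) = D (idx px y) + cost s y"
    | (question) q where "q < r" "predecessor k \<gamma> y q = Suc py" "D (idx x py) \<noteq> 0" "st = 0" "px = x"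
        "D (idx x y) = D (idx x py)"
  proof -
    have "(D (idx x y), px, py, st) \<in> student_cands D x y m \<or>
        (D (idx x y), px, py, st) \<in> question_cands D x y r"
      using mem nostart unfolding cands_def by blast
    then show thesis
    proof
      assume "(D (idx x y), px, py, st) \<in> student_cands D x y m"
      then obtain s where "s < m" "PS (x * m + s) = Suc px" "D (idx px y) \<noteq> 0" "st = Suc s" "py = y"
        "D (idx x y) = D (idx px y) + CO (y * m + s)"
        unfolding student_cands_def by blast
      then show thesis
        using student[of s] PS'[OF b(1)] CO'[OF b(2)] by (simp add: cost_def)
    next
      assume "(D (idx x y), px, py, st) \<in> question_cands D x y r"
      then obtain q where "q < r" "PQ (y * r + q) = Suc py" "D (idx x py) \<noteq> 0" "st = 0" "px = x"
        "D (idx x y) = D (idx x py)"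
        unfolding question_cands_def by blast
      then show thesis using question[of q] PQ'[OF b(2)] by simp
    qed
  qed
  then have "trace D px py (if 0 < st then Y(st - 1 := y) else Y) \<and>
    Suc (px div W + py div W) = x div W + y div W"
  proof cases
    case student
    have tl: "tail k \<alpha> m px (s # Ls)" using tail_predecessor[OF \<alpha> t(1) student(2,1)] .
    then have s: "s \<notin> set Ls" by (simp add: tail_def)
    have nm: "{q. q < r \<and> \<not> member k \<gamma> y q} = set Lq" using t(2) by (simp add: tail_def)
    have up: "(if 0 < st then Y(st - 1 := y) else Y) = Y(s := y)" using student by simp
    have "(\<Sum>t\<in>set (s # Ls). cost t ((Y(s := y)) t)) = cost s y + (\<Sum>s\<in>set Ls. cost s (Y s))"
      using s by (simp cong: sum.cong_simp) (rule sum.cong, auto)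
    moreover have "sorted (map (\<lambda>t. (Y(s := y)) t div W) (s # Ls))"
    proof -
      have "map (\<lambda>t. (Y(s := y)) t div W) Ls = map (\<lambda>s. Y s div W) Ls"
        by (rule map_cong) (use s in auto)
      then have eq: "map (\<lambda>t. (Y(s := y)) t div W) (s # Ls) = y div W # map (\<lambda>s. Y s div W) Ls" by simp
      show ?thesis unfolding eq using t(5,6) by auto
    qed
    moreover have "\<forall>t\<in>set (s # Ls). (Y(s := y)) t div W \<le> r \<and> y div W \<le> (Y(s := y)) t div W \<and>
        {q. q < r \<and> \<not> member k \<gamma> ((Y(s := y)) t) q} = set (drop ((Y(s := y)) t div W - y div W) Lq)"
      using t(5) s b nm by auto
    ultimately have "trace D px py (Y(s := y))"
      unfolding trace_def student(5) using tl t(2,4) student(3,6)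
      by (intro exI[of _ "s # Ls"] exI[of _ Lq]) (simp only:, simp)
    then show ?thesis using predecessor_div[OF student(2)] student(5) unfolding up by simp
  next
    case question
    have tl: "tail k \<gamma> r py (q # Lq)" using tail_predecessor[OF \<gamma> t(2) question(2,1)] .
    have d: "y div W = Suc (py div W)" by (rule predecessor_div[OF question(2)])
    have "\<forall>s\<in>set Ls. Y s div W \<le> r \<and> py div W \<le> Y s div W \<and>
        {q. q < r \<and> \<not> member k \<gamma> (Y s) q} = set (drop (Y s div W - py div W) (q # Lq))"
    proof
      fix s assume "s \<in> set Ls"
      note a = t(5)[OF this, unfolded d]
      then have "drop (Y s div W - py div W) (q # Lq) = drop (Y s div W - Suc (py div W)) Lq"
        by (simp add: drop_Cons' Suc_diff_le)
      with a show "Y s div W \<le> r \<and> py div W \<le> Y s div W \<and>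
        {q. q < r \<and> \<not> member k \<gamma> (Y s) q} = set (drop (Y s div W - py div W) (q # Lq))"
        by (simp only: Suc_leD simp_thms)
    qed
    then have "trace D px py Y"
      unfolding trace_def question(5) using tl t question(3,6)
      by (intro exI[of _ Ls] exI[of _ "q # Lq"]) simp
    then show ?thesis using d question(4,5) by simp
  qed
  then show "trace D px py (if 0 < st then Y(st - 1 := y) else Y)"
    "Suc (px div W + py div W) = x div W + y div W" by auto
qed

definition edits :: "(nat \<Rightarrow> nat) \<Rightarrow> (nat \<times> nat) set" where
  "edits Y = {(s, q). s < m \<and> q < r \<and> ((s, q) \<in> E) \<noteq> member k \<gamma> (Y s) q}"

lemma edit_edits: "edit E (edits Y) = {(s, q). s < m \<and> q < r \<and> member k \<gamma> (Y s) q}"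
  using E by (auto simp: edit_def edits_def)

lemma card_edits: "card (edits Y) = (\<Sum>s<m. cost s (Y s))"
proof -
  have "edits Y = Sigma {..<m} (\<lambda>s. {q. q < r \<and> ((s, q) \<in> E) \<noteq> member k \<gamma> (Y s) q})"
    by (auto simp: edits_def)
  then show ?thesis by (simp add: cost_def)
qed

text \<open>At counts 0 both lists are complete orderings. The recorded suffixes of
  \<open>Lq\<close> are non-neighbours, so neighbourhoods are prefixes of \<open>Lq\<close>, which
  gives the interval property; sorted counts along \<open>Ls\<close> make these prefixes grow, which
  gives nestedness.\<close>

lemma trace_start:
  assumes tr: "trace D x y Y" and ok: "cell_ok (cands D x y) (D (idx x y), px, py, st)"
    and zero: "x div W + y div W = 0"
  shows "both_near_feasible {..<m} {..<r} E \<alpha> \<gamma> k (edits Y)"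
    "Suc (card (edits Y)) = D (idx (final_state k m) (final_state k r))"
proof -
  obtain Ls Lq where t: "tail k \<alpha> m x Ls" "tail k \<gamma> r y Lq" "D (idx x y) \<noteq> 0"
     "D (idx x y) + (\<Sum>s\<in>set Ls. cost s (Y s)) = D (idx (final_state k m) (final_state k r))"
     "\<And>s. s \<in> set Ls \<Longrightarrow> Y s div W \<le> r \<and> y div W \<le> Y s div W \<and>
        {q. q < r \<and> \<not> member k \<gamma> (Y s) q} = set (drop (Y s div W - y div W) Lq)"
     "sorted (map (\<lambda>s. Y s div W) Ls)"
    using tr unfolding trace_def by blast
  have z: "x div W = 0" "y div W = 0" using zero by auto
  then have "x < W" "y < W" by (simp_all add: div_eq_0_iff)
  note b = trace_bounds[OF tr]
  have "(D (idx x y), px, py, st) \<in> cands D x y"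
    using ok t(3) by (auto simp: cell_ok_def split: if_splits)
  \<comment> \<open>States of count 0 have no predecessor, so the start candidate is the only one
    left. Its value 1 is the offset by which the table exceeds the true cost.\<close>
  then have D1: "D (idx x y) = 1"
    using \<open>x < W\<close> \<open>y < W\<close> b PS' PQ' predecessor_first
    by (auto simp: cands_def student_cands_def question_cands_def start_cands_def split: if_splits)
  note Ls = tail_complete[OF t(1) z(1)] and Lq = tail_complete[OF t(2) z(2)]
  show "Suc (card (edits Y)) = D (idx (final_state k m) (final_state k r))"
    using t(4) by (simp add: D1 card_edits Ls(1))
  obtain \<pi> where \<pi>: "ordering_of {..<m} \<pi>" "near k {..<m} \<alpha> \<pi>" "\<And>t. t < m \<Longrightarrow> \<pi> (Ls ! t) = Suc t"
    using Ls(3) by blast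
  obtain \<beta> where \<beta>: "ordering_of {..<r} \<beta>" "near k {..<r} \<gamma> \<beta>" "\<And>t. t < r \<Longrightarrow> \<beta> (Lq ! t) = Suc t"
    using Lq(3) by blast
  have non: "Y s div W \<le> r" "{q. q < r \<and> \<not> member k \<gamma> (Y s) q} = set (drop (Y s div W) Lq)" if "s < m" for s
    using t(5)[of s] that Ls(1) z by auto
  have N: "edit E (edits Y) `` {s} = {..<r} - set (drop (Y s div W) Lq)" if "s < m" for s
    using non(2)[OF that] that unfolding edit_edits by blast
  have "nested {..<m} (edit E (edits Y)) \<pi>"
    unfolding nested_def
  proof (intro ballI impI)
    fix s1 s2 assume s: "s1 \<in> {..<m}" "s2 \<in> {..<m}" "\<pi> s2 \<le> \<pi> s1"
    obtain t1 t2 where t12: "t1 < m" "s1 = Ls ! t1" "t2 < m" "s2 = Ls ! t2"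
      using s Ls(1,2) by (metis in_set_conv_nth)
    then have "t2 \<le> t1" using s(3) \<pi>(3) by simp
    then have "Y s2 div W \<le> Y s1 div W"
      using sorted_nth_mono[OF t(6), of t2 t1] t12 Ls(2) by simp
    then have "set (drop (Y s1 div W) Lq) \<subseteq> set (drop (Y s2 div W) Lq)"
      by (rule set_drop_subset_set_drop)
    then show "edit E (edits Y) `` {s2} \<subseteq> edit E (edits Y) `` {s1}"
      using N s by auto
  qed
  moreover have "interval_property {..<m} {..<r} (edit E (edits Y)) \<beta>"
    unfolding interval_property_def
  proof
    fix s assume "s \<in> {..<m}"
    then have s: "s < m" by simp
    define j where "j = Y s div W"
    have d: "distinct Lq" using t(2) by (simp add: tail_def)
    have "set Lq = set (take j Lq) \<union> set (drop j Lq)" by (metis append_take_drop_id set_append)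
    moreover have "set (take j Lq) \<inter> set (drop j Lq) = {}"
      by (rule set_take_disj_set_drop_if_distinct[OF d]) simp
    ultimately have "edit E (edits Y) `` {s} = set (take j Lq)"
      using N[OF s] Lq(1) by (auto simp: j_def)
    also have "\<dots> = (!) Lq ` {..<j}"
      using non(1)[OF s] Lq(2) by (simp add: nth_image j_def lessThan_atLeast0)
    also have "\<dots> = (\<lambda>t. inv_into {..<r} \<beta> (Suc t)) ` {..<j}"
    proof (rule image_cong)
      fix t assume "t \<in> {..<j}"
      then have tr: "t < r" using non(1)[OF s] by (simp add: j_def)
      then have "Lq ! t \<in> {..<r}" using Lq(1,2) nth_mem by metis
      then show "Lq ! t = inv_into {..<r} \<beta> (Suc t)"
        using inv_into_f_f[OF ordering_inj[OF \<beta>(1)]] \<beta>(3)[OF tr] by metis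
    qed simp
    also have "\<dots> = inv_into {..<r} \<beta> ` {1..j}"
      by (simp add: image_image[symmetric] image_Suc_lessThan)
    finally show "\<exists>j\<in>{0..card {..<r}}. edit E (edits Y) `` {s} = inv_into {..<r} \<beta> ` {1..j}"
      using non(1)[OF s] by (auto simp: j_def)
  qed
  moreover have "edits Y \<subseteq> {..<m} \<times> {..<r}" by (auto simp: edits_def)
  ultimately show "both_near_feasible {..<m} {..<r} E \<alpha> \<gamma> k (edits Y)"
    unfolding both_near_feasible_def using \<pi> \<beta> by blast
qed

section \<open>Completeness: the table undercuts every feasible edit set\<close>

lemma final_state_0: "final_state k 0 = S0"
  by (simp add: final_state_def S0_def)

text \<open>A feasible \<open>F\<close> gives a path through the genuine prefix states of \<pi> and
  \<beta>: a student of degree \<open>j\<close> is inserted when exactly \<open>j\<close> questions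
  are present. The costs along this path add up to \<open>card F\<close>, so the table value of the
  last cell, being minimal, is at most one more.\<close>

lemma dp_complete:
  assumes dp: "dp_table D PX PY ST"
    and feas: "both_near_feasible {..<m} {..<r} E \<alpha> \<gamma> k F"
  shows "D (idx (final_state k m) (final_state k r)) \<noteq> 0"
    "D (idx (final_state k m) (final_state k r)) \<le> Suc (card F)"
proof -
  define G where "G = edit E F"
  have F: "F \<subseteq> {..<m} \<times> {..<r}" using feas by (simp add: both_near_feasible_def)
  obtain \<pi> \<beta> where \<pi>: "ordering_of {..<m} \<pi>" "nested {..<m} G \<pi>" "near k {..<m} \<alpha> \<pi>"
    and \<beta>: "ordering_of {..<r} \<beta>" "interval_property {..<m} {..<r} G \<beta>" "near k {..<r} \<gamma> \<beta>"
    using feas unfolding both_near_feasible_def G_def by blast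
  have img: "inv_into {..<r} \<beta> ` {1..j} = {q. q < r \<and> \<beta> q \<le> j}" if "j \<le> r" for j
  proof
    have im: "\<beta> ` {..<r} = {1..r}" using \<beta>(1) by (simp add: ordering_of_def bij_betw_def)
    show "inv_into {..<r} \<beta> ` {1..j} \<subseteq> {q. q < r \<and> \<beta> q \<le> j}"
    proof clarify
      fix v assume "v \<in> {1..j}"
      then have v: "v \<in> \<beta> ` {..<r}" "v \<le> j" using im that by auto
      show "inv_into {..<r} \<beta> v < r \<and> \<beta> (inv_into {..<r} \<beta> v) \<le> j"
        using inv_into_into[OF v(1)] f_inv_into_f[OF v(1)] v(2) by simp
    qed
    show "{q. q < r \<and> \<beta> q \<le> j} \<subseteq> inv_into {..<r} \<beta> ` {1..j}"
    proof clarify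
      fix q assume q: "q < r" "\<beta> q \<le> j"
      then show "q \<in> inv_into {..<r} \<beta> ` {1..j}"
        using ordering_ge[OF \<beta>(1) q(1)] inv_into_f_f[OF ordering_inj[OF \<beta>(1)], of q]
        by (intro image_eqI[of _ _ "\<beta> q"]) auto
    qed
  qed
  have "\<forall>s<m. \<exists>j\<le>r. G `` {s} = {q. q < r \<and> \<beta> q \<le> j}"
    using \<beta>(2) img unfolding interval_property_def by fastforce
  then obtain deg where deg: "\<And>s. s < m \<Longrightarrow> deg s \<le> r"
    "\<And>s. s < m \<Longrightarrow> G `` {s} = {q. q < r \<and> \<beta> q \<le> deg s}" by metis
  \<comment> \<open>The last question in the interval of \<open>s\<close> must also be a neighbour
    of \<open>s'\<close>, which forces the interval of \<open>s'\<close> to be at least as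
    long.\<close>
  have mono: "deg s \<le> deg s'" if a: "s < m" "s' < m" "\<pi> s \<le> \<pi> s'" for s s'
  proof (cases "deg s = 0")
    case False
    then obtain q where q: "q < r" "\<beta> q = deg s"
      using ordering_surj[OF \<beta>(1), of "deg s"] deg(1)[OF a(1)] by auto
    then have "q \<in> G `` {s}" using deg(2)[OF a(1)] by simp
    then have "q \<in> G `` {s'}" using \<pi>(2) a unfolding nested_def by blast
    then show ?thesis using deg(2)[OF a(2)] q by simp
  qed simp
  obtain X where X: "X 0 = final_state k 0" "X m = final_state k m" "\<And>i. X i div W = i"
    "\<And>i s. s < m \<Longrightarrow> \<pi> s = Suc i \<Longrightarrow> predecessor k \<alpha> (X (Suc i)) s = Suc (X i)"
    by (rule ordering_states[OF \<alpha> \<pi>(1,3) k]) blast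
  obtain Y where Y: "Y 0 = final_state k 0" "Y r = final_state k r" "\<And>j. Y j div W = j"
    "\<And>j q. q < r \<Longrightarrow> \<beta> q = Suc j \<Longrightarrow> predecessor k \<gamma> (Y (Suc j)) q = Suc (Y j)"
    "\<And>j q. q < r \<Longrightarrow> member k \<gamma> (Y j) q \<longleftrightarrow> \<beta> q \<le> j"
    by (rule ordering_states[OF \<gamma> \<beta>(1,3) k]) blast
  define c where "c s = cost s (Y (deg s))" for s
  have memb: "member k \<gamma> (Y (deg s)) q \<longleftrightarrow> (s, q) \<in> G" if "s < m" "q < r" for s q
    using deg(2)[OF that(1)] Y(5)[OF that(2), of "deg s"] that(2) by auto
  have "F = edits (\<lambda>s. Y (deg s))"
  proof (rule set_eqI, clarify)
    fix s q
    have "((s, q) \<in> F) = (((s, q) \<in> E) \<noteq> ((s, q) \<in> G))" by (auto simp: G_def edit_def)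
    then show "(s, q) \<in> F \<longleftrightarrow> (s, q) \<in> edits (\<lambda>s. Y (deg s))"
      using F memb by (auto simp: edits_def)
  qed
  then have cF: "card F = (\<Sum>s<m. c s)" by (simp add: card_edits c_def)
  have relax: "D (idx x y) \<noteq> 0 \<and> D (idx x y) \<le> v"
    if "x < NX" "y < NY" "(v, a) \<in> cands D x y" for x y v a
    using dp that unfolding dp_table_def cell_ok_def Let_def by (fastforce split: if_splits)
  have bX: "X i < NX" if "i \<le> m" for i using that X(3) by (simp add: less_NX)
  have bY: "Y j < NY" if "j \<le> r" for j using that Y(3) by (simp add: less_NY)
  \<comment> \<open>The claim covers all lattice points at which no inserted student has degree
    above \<open>j\<close>, not just those on the path. Going back, the last student is removed if
    its degree equals \<open>j\<close>. Otherwise it is smaller, by monotonicity so are all earlier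
    degrees, and question \<open>j\<close> can be removed without violating the side
    condition.\<close>
  have main: "D (idx (X i) (Y j)) \<noteq> 0 \<and> D (idx (X i) (Y j)) \<le> Suc (\<Sum>s | s < m \<and> \<pi> s \<le> i. c s)"
    if "i \<le> m" "j \<le> r" "\<And>s. s < m \<Longrightarrow> \<pi> s \<le> i \<Longrightarrow> deg s \<le> j" for i j
    using that
  proof (induction "i + j" arbitrary: i j rule: less_induct)
    case less
    have question: ?case if j: "0 < j" and small: "\<And>s. s < m \<Longrightarrow> \<pi> s \<le> i \<Longrightarrow> deg s \<le> j - 1"
    proof -
      obtain j' where j': "j = Suc j'" using j by (cases j) auto
      obtain q where q: "q < r" "\<beta> q = Suc j'"
        using ordering_surj[OF \<beta>(1), of j] less.prems j' by auto
      have IH: "D (idx (X i) (Y j')) \<noteq> 0 \<and> D (idx (X i) (Y j')) \<le> Suc (\<Sum>s | s < m \<and> \<pi> s \<le> i. c s)"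
        by (rule less.hyps) (use less.prems j' small in auto)
      have "PQ (Y j * r + q) = Suc (Y j')"
        using Y(4)[OF q] PQ'[OF bY q(1), of j] less.prems by (simp add: j')
      then have "(D (idx (X i) (Y j')), X i, Y j', 0) \<in> cands D (X i) (Y j)"
        unfolding cands_def question_cands_def using IH q(1) by blast
      from relax[OF bX bY this] less.prems IH show ?thesis by auto
    qed
    show ?case
    proof (cases i)
      case 0
      show ?thesis
      proof (cases "j = 0")
        case True
        have "(1, 0, 0, 0) \<in> cands D (X i) (Y j)"
          using 0 True X(1) Y(1) final_state_0 by (simp add: cands_def start_cands_def)
        from relax[OF bX bY this] less.prems show ?thesis by auto
      next
        case False
        show ?thesis
          by (rule question) (use False 0 ordering_ge[OF \<pi>(1)] in fastforce)+
      qed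
    next
      case (Suc i')
      obtain s where s: "s < m" "\<pi> s = Suc i'"
        using ordering_surj[OF \<pi>(1), of i] less.prems Suc by auto
      show ?thesis
      proof (cases "deg s = j")
        case True
        have IH: "D (idx (X i') (Y j)) \<noteq> 0 \<and> D (idx (X i') (Y j)) \<le> Suc (\<Sum>s | s < m \<and> \<pi> s \<le> i'. c s)"
          by (rule less.hyps) (use less.prems Suc in auto)
        have "PS (X i * m + s) = Suc (X i')"
          using X(4)[OF s] PS'[OF bX s(1), of i] less.prems by (simp add: Suc)
        moreover have "CO (Y j * m + s) = c s"
          using CO'[OF bY s(1), of j] less.prems by (simp add: c_def cost_def True)
        ultimately have "(D (idx (X i') (Y j)) + c s, X i', Y j, Suc s) \<in> cands D (X i) (Y j)"
          unfolding cands_def student_cands_def using IH s(1) by force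
        from relax[OF bX bY this] less.prems
        have "D (idx (X i) (Y j)) \<noteq> 0 \<and> D (idx (X i) (Y j)) \<le> D (idx (X i') (Y j)) + c s" by auto
        moreover have "t < m \<and> \<pi> t \<le> i \<longleftrightarrow> t = s \<or> t < m \<and> \<pi> t \<le> i'" for t
          using inj_onD[OF ordering_inj[OF \<pi>(1)], of t s] s Suc by (auto simp: le_Suc_eq)
        then have "{t. t < m \<and> \<pi> t \<le> i} = insert s {t. t < m \<and> \<pi> t \<le> i'}" by blast
        then have "(\<Sum>t | t < m \<and> \<pi> t \<le> i. c t) = c s + (\<Sum>t | t < m \<and> \<pi> t \<le> i'. c t)"
          using s by simp
        ultimately show ?thesis using IH by auto
      next
        case False
        then have "deg s < j" using less.prems(3)[OF s(1)] s Suc by simp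
        moreover have "deg t \<le> deg s" if "t < m" "\<pi> t \<le> i" for t
          using mono[OF that(1) s(1)] that s Suc by simp
        ultimately show ?thesis by (intro question) fastforce+
      qed
    qed
  qed
  have "{s. s < m \<and> \<pi> s \<le> m} = {..<m}" using ordering_le[OF \<pi>(1)] by auto
  then show "D (idx (final_state k m) (final_state k r)) \<noteq> 0"
    "D (idx (final_state k m) (final_state k r)) \<le> Suc (card F)"
    using main[of m r] deg(1) X(2) Y(2) cF by auto
qed

text \<open>Some feasible edit set must exist for the final cell to be reachable, which is where the
  backward walk begins. The edgeless graph satisfies both conditions under the initial
  orderings.\<close>

lemma delete_all_edges_feasible: "both_near_feasible {..<m} {..<r} E \<alpha> \<gamma> k E"
proof -
  have "edit E E = {}" by (simp add: edit_def)
  moreover have "near k V f f" for V and f :: "nat \<Rightarrow> nat" by (simp add: near_def)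
  ultimately show ?thesis
    using E \<alpha> \<gamma> unfolding both_near_feasible_def nested_def interval_property_def
    by (intro conjI exI[of _ \<alpha>] exI[of _ \<gamma>]) (auto intro: bexI[of _ 0])
qed

lemma solution_edits:
  assumes dp: "dp_table D PX PY ST" and tr: "trace D x y Y" and zero: "x div W + y div W = 0"
  shows "both_near_solution {..<m} {..<r} E \<alpha> \<gamma> k (edits Y)"
proof -
  have "cell_ok (cands D x y) (D (idx x y), PX (idx x y), PY (idx x y), ST (idx x y))"
    using dp trace_bounds[OF tr] by (simp add: dp_table_def Let_def)
  from trace_start[OF tr this zero] dp_complete(2)[OF dp] show ?thesis
    unfolding both_near_solution_def by (metis Suc_le_mono)
qed

end

section \<open>Reading off a solution\<close>

definition p_step :: prog where
  "p_step = PAssign 24 (Plus (Arr 11 (Reg 16)) (Reg 17)) ;; PAssign 29 (Arr 15 (Reg 24)) ;;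
     PIf (Less (Const 0) (Reg 29)) (PStore 16 (Minus (Reg 29) (Const 1)) (Reg 17)) PSkip ;;
     PAssign 16 (Arr 13 (Reg 24)) ;; PAssign 17 (Arr 14 (Reg 24))"

lemma p_step_frame [simp]: "wregs p_step = {16, 17, 24, 29}" "warrs p_step = {16}"
  by (auto simp: p_step_def)

text \<open>Every step removes one student or one question, so exactly \<open>m + r\<close> rounds
  lead to counts 0. Subtracting the number of masks from the number of states yields the last row
  offset without multiplication.\<close>

definition p_back :: prog where
  "p_back = PAssign 16 (Plus (Minus (Reg 8) (Reg 4)) (Reg 5)) ;;
     PAssign 17 (Plus (Minus (Reg 9) (Reg 4)) (Reg 5)) ;; PFor 13 10 p_step"

lemma p_back_frame [simp]: "wregs p_back = {13, 16, 17, 24, 29}" "warrs p_back = {16}"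
  by (auto simp: p_back_def)

definition p_out_row :: prog where
  "p_out_row = PFor 15 1 (
     PIf (Equal (Arr 2 (Reg 30)) (Arr 8 (Plus (Reg 23) (Reg 15))))
       (PStore 3 (Reg 30) (Const 0)) (PStore 3 (Reg 30) (Const 1)) ;;
     PAssign 30 (plus1 (Reg 30)))"

lemma p_out_row_frame [simp]: "wregs p_out_row = {15, 30}" "warrs p_out_row = {3}"
  by (auto simp: p_out_row_def)

definition p_out :: prog where
  "p_out = PAssign 30 (Const 0) ;;
     PFor 14 0 (PAssign 23 (Arr 17 (Arr 16 (Reg 14))) ;; p_out_row)"

lemma p_out_frame [simp]: "wregs p_out = {14, 15, 23, 30}" "warrs p_out = {3}"
  by (auto simp: p_out_def)

definition out_ok :: "nat \<Rightarrow> nat \<Rightarrow> store \<Rightarrow> bool" where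
  "out_ok r N \<sigma> \<longleftrightarrow> (\<forall>j<N. arr \<sigma> 3 j =
     of_bool (arr \<sigma> 2 j \<noteq> arr \<sigma> 8 (arr \<sigma> 17 (arr \<sigma> 16 (j div r)) + j mod r)))"

lemma p_out_row:
  assumes "reg \<sigma> 1 = r" "reg \<sigma> 30 = s * r" "reg \<sigma> 23 = arr \<sigma> 17 (arr \<sigma> 16 s)" "out_ok r (s * r) \<sigma>"
  shows "reg (ev p_out_row \<sigma>) 30 = Suc s * r" "out_ok r (Suc s * r) (ev p_out_row \<sigma>)"
proof -
  define I where "I q \<tau> \<longleftrightarrow> reg \<tau> 30 = s * r + q \<and> out_ok r (s * r + q) \<tau>" for q and \<tau> :: store
  have "I (reg \<sigma> 1) (ev p_out_row \<sigma>)"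
    unfolding p_out_row_def
  proof (rule for_invariant, goal_cases)
    case 1
    show ?case using assms by (simp add: I_def out_ok_def)
  next
    case (2 q \<tau>)
    note fr = 2(4) and fa = 2(5)
    have q: "q < r" "reg \<tau> 15 = q" and I: "reg \<tau> 30 = s * r + q" "out_ok r (s * r + q) \<tau>"
      using 2 unfolding assms(1) by (auto simp: I_def)
    have "reg \<tau> 23 = arr \<tau> 17 (arr \<tau> 16 s)" using fr fa assms(3) by simp
    then show ?case using I q by (auto simp: I_def out_ok_def less_Suc_eq)
  qed
  then show "reg (ev p_out_row \<sigma>) 30 = Suc s * r" "out_ok r (Suc s * r) (ev p_out_row \<sigma>)"
    unfolding assms(1) by (simp_all add: I_def add.commute)
qed

lemma p_out:
  assumes "reg \<sigma> 0 = m" "reg \<sigma> 1 = r"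
  shows "out_ok r (m * r) (ev p_out \<sigma>)"
proof -
  define I where "I s \<tau> \<longleftrightarrow> reg \<tau> 30 = s * r \<and> out_ok r (s * r) \<tau>" for s and \<tau> :: store
  let ?body = "PAssign 23 (Arr 17 (Arr 16 (Reg 14))) ;; p_out_row"
  have "I (reg (setr 30 0 \<sigma>) 0) (ev (PFor 14 0 ?body) (setr 30 0 \<sigma>))"
  proof (rule for_invariant, goal_cases)
    case 1
    show ?case by (simp add: I_def out_ok_def)
  next
    case (2 s \<tau>)
    note fr = 2(4)
    define \<tau>' where "\<tau>' = setr 23 (arr \<tau> 17 (arr \<tau> 16 s)) \<tau>"
    have "reg \<tau>' 1 = r" using fr assms by (simp add: \<tau>'_def)
    moreover have "reg \<tau>' 30 = s * r" "out_ok r (s * r) \<tau>'"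
      using 2 by (simp_all add: I_def \<tau>'_def out_ok_def)
    ultimately have "I (Suc s) (setr 14 (Suc s) (ev p_out_row \<tau>'))"
      using p_out_row[of \<tau>' r s] by (simp add: I_def \<tau>'_def out_ok_def)
    then show ?case using 2 by (simp add: \<tau>'_def)
  qed
  then show ?thesis using assms by (simp add: I_def p_out_def)
qed

context chain_dp
begin

lemma p_back:
  assumes "reg \<sigma> 10 = m + r" "reg \<sigma> 8 = NX" "reg \<sigma> 9 = NY" "reg \<sigma> 4 = W" "reg \<sigma> 5 = S0"
    and rows: "\<And>x. x < NX \<Longrightarrow> arr \<sigma> 11 x = x * NY"
    and dp: "dp_table (arr \<sigma> 12) (arr \<sigma> 13) (arr \<sigma> 14) (arr \<sigma> 15)"
  shows "\<exists>x y. trace (arr \<sigma> 12) x y (arr (ev p_back \<sigma>) 16) \<and> x div W + y div W = 0"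
proof -
  define I where "I t \<tau> \<longleftrightarrow> trace (arr \<sigma> 12) (reg \<tau> 16) (reg \<tau> 17) (arr \<tau> 16) \<and>
     reg \<tau> 16 div W + reg \<tau> 17 div W + t = m + r" for t and \<tau> :: store
  define \<sigma>0 where "\<sigma>0 = setr 17 (final_state k r) (setr 16 (final_state k m) \<sigma>)"
  have nz: "arr \<sigma> 12 (idx (final_state k m) (final_state k r)) \<noteq> 0"
    using dp_complete(1)[OF dp delete_all_edges_feasible] .
  have fs: "NX - W + S0 = final_state k m" "NY - W + S0 = final_state k r"
    by (simp_all add: NX_def NY_def S0_def final_state_def)
  have "I (reg \<sigma>0 10) (ev (PFor 13 10 p_step) \<sigma>0)"
  proof (rule for_invariant, goal_cases)
    case 1
    show ?case using trace_final[of "arr \<sigma> 12", OF nz] by (simp add: I_def \<sigma>0_def)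
  next
    case (2 t \<tau>)
    note fa = 2(5)
    define x where "x = reg \<tau> 16"
    define y where "y = reg \<tau> 17"
    have t: "t < m + r" using 2 assms by (simp add: \<sigma>0_def)
    have I: "trace (arr \<sigma> 12) x y (arr \<tau> 16)" "x div W + y div W + t = m + r"
      using 2 by (auto simp: I_def x_def y_def)
    note b = trace_bounds[OF I(1)]
    have a: "arr \<tau> 11 x = x * NY" "arr \<tau> 13 = arr \<sigma> 13" "arr \<tau> 14 = arr \<sigma> 14" "arr \<tau> 15 = arr \<sigma> 15"
      using fa rows[OF b(1)] by (simp_all add: \<sigma>0_def)
    have ok: "cell_ok (cands (arr \<sigma> 12) x y) (arr \<sigma> 12 (idx x y), arr \<sigma> 13 (idx x y),
        arr \<sigma> 14 (idx x y), arr \<sigma> 15 (idx x y))"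
      using dp b by (simp add: dp_table_def Let_def)
    have "x div W + y div W > 0" using I(2) t by linarith
    note st = trace_step[OF I(1) ok this]
    show ?case
      using st I(2) a by (cases "0 < arr \<sigma> 15 (idx x y)")
        (auto simp: I_def p_step_def simp flip: x_def y_def)
  qed
  moreover have "reg \<sigma>0 10 = m + r" using assms by (simp add: \<sigma>0_def)
  moreover have "ev (PFor 13 10 p_step) \<sigma>0 = ev p_back \<sigma>"
    using assms fs by (simp add: \<sigma>0_def p_back_def)
  ultimately have "I (m + r) (ev p_back \<sigma>)" by (simp only:)
  then show ?thesis unfolding I_def by (metis add_cancel_left_left)
qed

text \<open>Needed so that the output stage looks up recorded question states only inside the
  tabulated range.\<close>

lemma trace_bound_all:
  assumes "trace D x y Y" "x div W + y div W = 0" "s < m"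
  shows "Y s < NY"
proof -
  obtain Ls where Ls: "tail k \<alpha> m x Ls" "\<forall>s\<in>set Ls. Y s div W \<le> r"
    using assms(1) unfolding trace_def by blast
  have "set Ls = {..<m}" using tail_complete(1)[OF Ls(1)] assms(2) by simp
  then show ?thesis using Ls(2) assms(3) less_NY by blast
qed

end

section \<open>Sequential composition of stages\<close>

definition ready :: "prog \<Rightarrow> bool" where
  "ready p \<longleftrightarrow> counters_ok p \<and> limits p \<inter> wregs p = {}"

fun compile_all :: "prog list \<Rightarrow> com" where
  "compile_all [] = Skip"
| "compile_all (p # ps) = Seq (compile p) (compile_all ps)"

fun ev_all :: "prog list \<Rightarrow> store \<Rightarrow> store" where
  "ev_all [] \<sigma> = \<sigma>"
| "ev_all (p # ps) \<sigma> = ev_all ps (ev p \<sigma>)"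

fun time_all :: "prog list \<Rightarrow> store \<Rightarrow> nat" where
  "time_all [] \<sigma> = 1"
| "time_all (p # ps) \<sigma> = time p (reg \<sigma>) + time_all ps (ev p \<sigma>)"

lemma exec_ev_all:
  "list_all ready ps \<Longrightarrow> \<exists>t \<le> time_all ps \<sigma>. exec (compile_all ps) \<sigma> t (ev_all ps \<sigma>)"
proof (induction ps arbitrary: \<sigma>)
  case Nil
  show ?case using exec.Skip[of \<sigma>] by auto
next
  case (Cons p ps)
  obtain t where t: "t \<le> time p (reg \<sigma>)" "exec (compile p) \<sigma> t (ev p \<sigma>)"
    using exec_ev[of p \<sigma>] Cons.prems by (auto simp: ready_def)
  obtain u where u: "u \<le> time_all ps (ev p \<sigma>)" "exec (compile_all ps) (ev p \<sigma>) u (ev_all ps (ev p \<sigma>))"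
    using Cons by auto
  show ?case using exec.Seq[OF t(2) u(2)] t u by (intro exI[of _ "t + u"]) auto
qed

text \<open>Early stages compute registers that limit the loops of later ones, so the concatenated
  program would violate the disjointness of limits and written registers. Each stage by itself
  satisfies it, and its time is evaluated in the store that it actually starts from.\<close>

definition stages :: "prog list" where
  "stages = [p_setup, p_powers, p_build 0 6 0 6 7 ;; PAssign 8 (Reg 16),
     p_build 1 7 1 8 9 ;; PAssign 9 (Reg 16), p_cost, p_dp, p_back, p_out]"

lemma stages_ready: "list_all ready stages"
  by (auto simp: stages_def ready_def p_setup_def p_powers_def p_build_def p_states_def p_decode_def
      p_fill_def p_cost_def p_cost_row_def p_count_def p_dp_def p_dp_row_def p_cell_def
      p_relax_students_def p_relax_questions_def p_relax_def p_back_def p_step_def p_out_def p_out_row_def)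


lemma index_less: "x < M \<Longrightarrow> s < n \<Longrightarrow> x * n + s < M * (n :: nat)"
  by (metis add_less_cancel_left le_trans less_le_trans mult_Suc add.commute Suc_leI mult_le_mono1)

lemma tables_okD:
  assumes "tables_ok k n f me pr (M * n) \<sigma>" "x < M" "s < n"
  shows "arr \<sigma> me (x * n + s) = of_bool (member k f x s)" "arr \<sigma> pr (x * n + s) = predecessor k f x s"
  using assms index_less[OF assms(2,3)] by (simp_all add: tables_ok_def)

lemma of_bool_neq_iff: "(of_bool P :: nat) \<noteq> of_bool Q \<longleftrightarrow> P \<noteq> Q"
  by auto

section \<open>The complete run on one instance\<close>

locale run =
  fixes m r k :: nat and E :: "(nat \<times> nat) set" and \<alpha> \<gamma> :: "nat \<Rightarrow> nat"
  assumes inst: "both_near_instance {..<m} {..<r} E \<alpha> \<gamma> k"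
begin

definition "\<sigma>0 = input_store m r E \<alpha> \<gamma> k"
definition "\<sigma>1 = ev p_setup \<sigma>0"
definition "\<sigma>2 = ev p_powers \<sigma>1"
definition "\<sigma>3 = ev (p_build 0 6 0 6 7 ;; PAssign 8 (Reg 16)) \<sigma>2"
definition "\<sigma>4 = ev (p_build 1 7 1 8 9 ;; PAssign 9 (Reg 16)) \<sigma>3"
definition "\<sigma>5 = ev p_cost \<sigma>4"
definition "\<sigma>6 = ev p_dp \<sigma>5"
definition "\<sigma>7 = ev p_back \<sigma>6"
definition "\<sigma>8 = ev p_out \<sigma>7"

lemma ev_all_stages: "ev_all stages (input_store m r E \<alpha> \<gamma> k) = \<sigma>8"
  by (simp add: stages_def \<sigma>0_def \<sigma>1_def \<sigma>2_def \<sigma>3_def \<sigma>4_def \<sigma>5_def \<sigma>6_def \<sigma>7_def \<sigma>8_def)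

lemma reg1: "reg \<sigma>1 0 = m" "reg \<sigma>1 1 = r" "reg \<sigma>1 2 = k" "reg \<sigma>1 3 = 2 * k + 1" "reg \<sigma>1 32 = 1"
  "reg \<sigma>1 6 = Suc m" "reg \<sigma>1 7 = Suc r" "reg \<sigma>1 10 = m + r"
  by (simp_all add: \<sigma>1_def \<sigma>0_def p_setup_def input_store_def)

lemma arr1: "arr \<sigma>1 = arr \<sigma>0"
  by (rule ext) (simp add: \<sigma>1_def)

lemma reg2: "reg \<sigma>2 0 = m" "reg \<sigma>2 1 = r" "reg \<sigma>2 2 = k" "reg \<sigma>2 3 = 2 * k + 1"
  "reg \<sigma>2 4 = 2 ^ (2 * k)" "reg \<sigma>2 5 = 2 ^ k - 1"
  "reg \<sigma>2 6 = Suc m" "reg \<sigma>2 7 = Suc r" "reg \<sigma>2 10 = m + r"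
  and pw2: "\<And>u. u < 2 * k + 1 \<Longrightarrow> arr \<sigma>2 4 u = 2 ^ u"
  using p_powers[OF reg1(3,4,5)] reg1 by (simp_all add: \<sigma>2_def)

lemma arr2: "A \<noteq> 4 \<Longrightarrow> arr \<sigma>2 A = arr \<sigma>0 A"
  by (simp add: \<sigma>2_def arr1)

lemma build_students:
  "reg \<sigma>3 8 = Suc m * 2 ^ (2 * k)" "tables_ok k m \<alpha> 6 7 (Suc m * 2 ^ (2 * k) * m) \<sigma>3"
  "scratch_ok k \<sigma>3"
proof -
  have "params_ok k m \<alpha> 0 0 \<sigma>2"
    using reg2 pw2 by (simp add: params_ok_def arr2 \<sigma>0_def input_store_def)
  moreover have "scratch_ok k \<sigma>2" by (simp add: scratch_ok_def arr2 \<sigma>0_def input_store_def)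
  ultimately have "scratch_ok k (ev (p_build 0 6 0 6 7) \<sigma>2)"
    "reg (ev (p_build 0 6 0 6 7) \<sigma>2) 16 = Suc m * 2 ^ (2 * k)"
    "tables_ok k m \<alpha> 6 7 (Suc m * 2 ^ (2 * k) * m) (ev (p_build 0 6 0 6 7) \<sigma>2)"
    using p_build[of 0 6 6 7 0 k m \<alpha> \<sigma>2] reg2(7) by auto
  then show "reg \<sigma>3 8 = Suc m * 2 ^ (2 * k)" "tables_ok k m \<alpha> 6 7 (Suc m * 2 ^ (2 * k) * m) \<sigma>3"
    "scratch_ok k \<sigma>3"
    by (simp_all add: \<sigma>3_def tables_ok_def scratch_ok_def)
qed

lemma frame3: "y \<notin> {8, 11, 12, 13, 14, 16, 18, 19, 20, 25} \<Longrightarrow> reg \<sigma>3 y = reg \<sigma>2 y"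
  "A \<notin> {5, 6, 7} \<Longrightarrow> arr \<sigma>3 A = arr \<sigma>2 A"
  by (simp_all add: \<sigma>3_def)

lemma build_questions:
  "reg \<sigma>4 9 = Suc r * 2 ^ (2 * k)" "tables_ok k r \<gamma> 8 9 (Suc r * 2 ^ (2 * k) * r) \<sigma>4"
proof -
  have "params_ok k r \<gamma> 1 1 \<sigma>3"
    using reg2 pw2 frame3(1)[of 1] by (simp add: params_ok_def frame3 arr2 \<sigma>0_def input_store_def)
  then have "reg (ev (p_build 1 7 1 8 9) \<sigma>3) 16 = Suc r * 2 ^ (2 * k)"
    "tables_ok k r \<gamma> 8 9 (Suc r * 2 ^ (2 * k) * r) (ev (p_build 1 7 1 8 9) \<sigma>3)"
    using p_build[of 1 7 8 9 1 k r \<gamma> \<sigma>3] build_students(3) reg2(8) frame3(1)[of 7] by auto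
  then show "reg \<sigma>4 9 = Suc r * 2 ^ (2 * k)" "tables_ok k r \<gamma> 8 9 (Suc r * 2 ^ (2 * k) * r) \<sigma>4"
    by (simp_all add: \<sigma>4_def tables_ok_def)
qed

lemma frame4: "y \<notin> {9, 11, 12, 13, 14, 16, 18, 19, 20, 25} \<Longrightarrow> reg \<sigma>4 y = reg \<sigma>3 y"
  "A \<notin> {5, 8, 9} \<Longrightarrow> arr \<sigma>4 A = arr \<sigma>3 A"
  by (simp_all add: \<sigma>4_def)

lemma reg4: "reg \<sigma>4 0 = m" "reg \<sigma>4 1 = r" "reg \<sigma>4 4 = 2 ^ (2 * k)" "reg \<sigma>4 5 = 2 ^ k - 1"
  "reg \<sigma>4 8 = Suc m * 2 ^ (2 * k)" "reg \<sigma>4 9 = Suc r * 2 ^ (2 * k)" "reg \<sigma>4 10 = m + r"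
  using reg2 frame3(1) frame4(1) build_students(1) build_questions(1)
  by (simp_all add: frame3(1) frame4(1) del: One_nat_def)

lemma regs5: "y \<in> {0, 1, 4, 5, 8, 9, 10} \<Longrightarrow> reg \<sigma>5 y = reg \<sigma>4 y"
  and regs6: "y \<in> {0, 1, 4, 5, 8, 9, 10} \<Longrightarrow> reg \<sigma>6 y = reg \<sigma>4 y"
  and regs7: "y \<in> {0, 1, 4, 5, 8, 9, 10} \<Longrightarrow> reg \<sigma>7 y = reg \<sigma>4 y"
  by (auto simp: \<sigma>5_def \<sigma>6_def \<sigma>7_def)

lemma adjacency: "arr \<sigma>4 2 = arr \<sigma>0 2"
  by (simp add: frame4 frame3 arr2)

lemma adjacency_entry: "s < m \<Longrightarrow> q < r \<Longrightarrow> arr \<sigma>0 2 (s * r + q) = of_bool ((s, q) \<in> E)"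
  using index_less[of s m q r] by (simp add: \<sigma>0_def input_store_def)

lemma students: "x < Suc m * 2 ^ (2 * k) \<Longrightarrow> s < m \<Longrightarrow> arr \<sigma>5 7 (x * m + s) = predecessor k \<alpha> x s"
  using tables_okD(2)[OF build_students(2)] by (simp add: \<sigma>5_def frame4)

lemma questions: "y < Suc r * 2 ^ (2 * k) \<Longrightarrow> q < r \<Longrightarrow> arr \<sigma>5 9 (y * r + q) = predecessor k \<gamma> y q"
  and members: "y < Suc r * 2 ^ (2 * k) \<Longrightarrow> q < r \<Longrightarrow> arr \<sigma>4 8 (y * r + q) = of_bool (member k \<gamma> y q)"
  using tables_okD[OF build_questions(2)] by (simp_all add: \<sigma>5_def)

lemma costs:
  assumes "y < Suc r * 2 ^ (2 * k)" "s < m"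
  shows "arr \<sigma>5 10 (y * m + s) = card {q. q < r \<and> ((s, q) \<in> E) \<noteq> member k \<gamma> y q}"
proof -
  have "costs_ok m r (Suc r * 2 ^ (2 * k) * m) \<sigma>5"
    unfolding \<sigma>5_def by (rule p_cost(1)[OF reg4(1,2,6)])
  then have "arr \<sigma>5 10 (y * m + s) = mismatches (arr \<sigma>5 2) (arr \<sigma>5 8) r s y r"
    using index_less[OF assms] assms(2) by (simp add: costs_ok_def)
  also have "\<dots> = mismatches (arr \<sigma>0 2) (arr \<sigma>4 8) r s y r"
    by (simp add: \<sigma>5_def adjacency)
  also have "\<dots> = card {q. q < r \<and> ((s, q) \<in> E) \<noteq> member k \<gamma> y q}"
    unfolding mismatches_def
    by (intro arg_cong[of _ _ card] Collect_cong conj_cong refl)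
      (simp only: adjacency_entry members assms of_bool_neq_iff)
  finally show ?thesis .
qed

sublocale chain_dp m r k \<alpha> \<gamma> E "arr \<sigma>5 7" "arr \<sigma>5 9" "arr \<sigma>5 10"
  by unfold_locales (fact inst students questions costs)+

lemma correct: "both_near_solution {..<m} {..<r} E \<alpha> \<gamma> k (output_set m r \<sigma>8)"
proof -
  have R: "reg \<sigma>4 8 = NX" "reg \<sigma>4 9 = NY" "reg \<sigma>4 5 = S0" "reg \<sigma>4 4 = W"
    using reg4 by (simp_all only: NX_def NY_def S0_def)
  have "loaded \<sigma>5"
    unfolding loaded_def using R reg4(1,2) by (simp only: regs5 insert_iff simp_thms)
  note dp = p_dp[OF this, folded \<sigma>6_def]
  have dpt: "dp_table (arr \<sigma>6 12) (arr \<sigma>6 13) (arr \<sigma>6 14) (arr \<sigma>6 15)"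
    using dp(1) index_less unfolding dp_table_def dp_ok_def cell_def Let_def by blast
  obtain x y where tr: "trace (arr \<sigma>6 12) x y (arr \<sigma>7 16)" "x div W + y div W = 0"
    using p_back[of \<sigma>6, folded \<sigma>7_def] dpt dp(2) R reg4(7) regs6 by auto
  have sol: "both_near_solution {..<m} {..<r} E \<alpha> \<gamma> k (edits (arr \<sigma>7 16))"
    by (rule solution_edits[OF dpt tr])
  have "out_ok r (m * r) \<sigma>8"
    unfolding \<sigma>8_def by (rule p_out) (use regs7 reg4 in auto)
  moreover have "arr \<sigma>8 2 = arr \<sigma>0 2" "arr \<sigma>8 8 = arr \<sigma>4 8" "arr \<sigma>8 16 = arr \<sigma>7 16" "arr \<sigma>8 17 = arr \<sigma>5 17"
    by (simp_all add: \<sigma>8_def \<sigma>7_def \<sigma>6_def \<sigma>5_def adjacency)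
  ultimately have out: "arr \<sigma>8 3 j = of_bool (arr \<sigma>0 2 j \<noteq> arr \<sigma>4 8 (arr \<sigma>5 17 (arr \<sigma>7 16 (j div r)) + j mod r))"
    if "j < m * r" for j using that by (simp add: out_ok_def)
  have "arr \<sigma>8 3 (s * r + q) = 1 \<longleftrightarrow> ((s, q) \<in> E) \<noteq> member k \<gamma> (arr \<sigma>7 16 s) q" if s: "s < m" "q < r" for s q
  proof -
    have Y: "arr \<sigma>7 16 s < NY" using trace_bound_all[OF tr s(1)] .
    have "arr \<sigma>5 17 (arr \<sigma>7 16 s) = arr \<sigma>7 16 s * r"
      unfolding \<sigma>5_def by (rule p_cost(2)[OF reg4(1,2,6)]) (use Y NY_def in simp)
    then show ?thesis
      using out[OF index_less[OF s]] s members[OF Y[unfolded NY_def] s(2)] adjacency_entry[OF s]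
      by simp
  qed
  then have "output_set m r \<sigma>8 = edits (arr \<sigma>7 16)"
    unfolding output_set_def edits_def by blast
  then show ?thesis using sol by simp
qed

end

section \<open>Running time\<close>

text \<open>Nested loops are bounded from the inside out as a constant times a product of limits.
  Since the product is at least 1, the overheads 6 and 8 of a loop cost at most 14 in the
  constant.\<close>

lemma for_bound:
  fixes T a X l L :: nat
  assumes "T \<le> a * X" "l \<le> L" "1 \<le> X" "1 \<le> L"
  shows "6 + l * (T + 8) \<le> (a + 14) * (L * X)"
proof -
  have "l * (T + 8) \<le> L * (a * X + 8 * X)"
    using assms by (intro mult_le_mono add_le_mono) auto
  moreover have "1 \<le> L * X" using assms by simp
  ultimately have "6 + l * (T + 8) \<le> 6 * (L * X) + L * (a * X + 8 * X)" by linarith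
  then show ?thesis by (simp add: algebra_simps)
qed

lemma time_p_setup: "time p_setup \<rho> \<le> 100"
  by (simp add: p_setup_def)

lemma time_p_powers: "\<rho> 3 \<le> K \<Longrightarrow> 1 \<le> K \<Longrightarrow> time p_powers \<rho> \<le> 100 * K"
  by (simp add: p_powers_def)

lemma time_p_decode: "\<rho> 3 \<le> K \<Longrightarrow> 1 \<le> K \<Longrightarrow> time p_decode \<rho> \<le> 150 * K"
  by (simp add: p_decode_def)

lemma time_p_fill: "\<rho> n \<le> M \<Longrightarrow> 1 \<le> M \<Longrightarrow> time (p_fill n al me pr) \<rho> \<le> 150 * M"
  by (simp add: p_fill_def)

lemma time_p_count: "\<rho> 1 \<le> M \<Longrightarrow> 1 \<le> M \<Longrightarrow> time p_count \<rho> \<le> 100 * M"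
  by (simp add: p_count_def)

lemma time_p_relax_students: "\<rho> 0 \<le> M \<Longrightarrow> 1 \<le> M \<Longrightarrow> time p_relax_students \<rho> \<le> 150 * M"
  by (simp add: p_relax_students_def p_relax_def)

lemma time_p_relax_questions: "\<rho> 1 \<le> M \<Longrightarrow> 1 \<le> M \<Longrightarrow> time p_relax_questions \<rho> \<le> 150 * M"
  by (simp add: p_relax_questions_def p_relax_def)

lemma time_p_back: "\<rho> 10 \<le> M \<Longrightarrow> 1 \<le> M \<Longrightarrow> time p_back \<rho> \<le> 100 * M"
  by (simp add: p_back_def p_step_def)

lemma time_p_out_row: "\<rho> 1 \<le> M \<Longrightarrow> 1 \<le> M \<Longrightarrow> time p_out_row \<rho> \<le> 100 * M"
  by (simp add: p_out_row_def)

lemma time_p_out: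
  assumes "\<rho> 0 \<le> M" "\<rho> 1 \<le> M" "1 \<le> M"
  shows "time p_out \<rho> \<le> 200 * (M * M)"
proof -
  have "4 + time p_out_row \<rho> \<le> 104 * M"
    using time_p_out_row[of \<rho> M, OF assms(2,3)] assms by linarith
  from for_bound[OF this assms(1,3,3)]
  have "6 + \<rho> 0 * ((4 + time p_out_row \<rho>) + 8) \<le> 118 * (M * M)" by simp
  moreover have "1 \<le> M * M" using assms by simp
  moreover have "time p_out \<rho> = 2 + (6 + \<rho> 0 * ((4 + time p_out_row \<rho>) + 8))"
    by (simp add: p_out_def)
  ultimately show ?thesis by linarith
qed

lemma time_p_states:
  assumes "\<rho> 3 \<le> K" "\<rho> 4 \<le> V" "\<rho> n \<le> M" "1 \<le> K" "1 \<le> V" "1 \<le> M"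
  shows "time (p_states n al me pr) \<rho> \<le> 400 * (V * (K * M))"
proof -
  have 1: "1 \<le> K * M" "K \<le> K * M" "M \<le> K * M" using assms by simp_all
  have "10 + time p_decode \<rho> + time (p_fill n al me pr) \<rho> \<le> 310 * (K * M)"
    using time_p_decode[of \<rho> K, OF assms(1,4)] time_p_fill[of \<rho> n M al me pr] assms(3,6) 1 by linarith
  from for_bound[OF this assms(2) 1(1) assms(5)]
  have "6 + \<rho> 4 * ((10 + time p_decode \<rho> + time (p_fill n al me pr) \<rho>) + 8) \<le> 324 * (V * (K * M))"
    by simp
  moreover have "time (p_states n al me pr) \<rho> =
      6 + \<rho> 4 * ((10 + time p_decode \<rho> + time (p_fill n al me pr) \<rho>) + 8)"
    by (simp add: p_states_def algebra_simps)
  ultimately show ?thesis by linarith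
qed

lemma time_p_build:
  assumes "\<rho> 3 \<le> K" "\<rho> 4 \<le> V" "\<rho> n \<le> M" "\<rho> n1 \<le> M" "1 \<le> K" "1 \<le> V" "1 \<le> M"
  shows "time (p_build n n1 al me pr ;; PAssign y (Reg 16)) \<rho> \<le> 500 * (M * (V * (K * M)))"
proof -
  have 1: "1 \<le> V * (K * M)" "1 \<le> M * (V * (K * M))" using assms by simp_all
  from for_bound[OF time_p_states assms(4) 1(1) assms(7), of \<rho> n al me pr] assms
  have "6 + \<rho> n1 * (time (p_states n al me pr) \<rho> + 8) \<le> 414 * (M * (V * (K * M)))" by simp
  moreover have "time (p_build n n1 al me pr ;; PAssign y (Reg 16)) \<rho> =
      6 + (6 + \<rho> n1 * (time (p_states n al me pr) \<rho> + 8))"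
    by (simp add: p_build_def)
  ultimately show ?thesis using 1(2) by linarith
qed

lemma time_p_cost:
  assumes "\<rho> 0 \<le> M" "\<rho> 1 \<le> M" "\<rho> 9 \<le> N" "1 \<le> M" "1 \<le> N"
  shows "time p_cost \<rho> \<le> 300 * (N * (M * M))"
proof -
  have "9 + time p_count \<rho> \<le> 110 * M"
    using time_p_count[of \<rho> M, OF assms(2,4)] assms by linarith
  from for_bound[OF this assms(1,4,4)]
  have "6 + \<rho> 0 * ((9 + time p_count \<rho>) + 8) \<le> 124 * (M * M)" by simp
  moreover have "time p_cost_row \<rho> = 6 + \<rho> 0 * ((9 + time p_count \<rho>) + 8)"
    by (simp add: p_cost_row_def algebra_simps)
  moreover have 1: "1 \<le> M * M" "1 \<le> N * (M * M)" using assms by simp_all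
  ultimately have "9 + time p_cost_row \<rho> \<le> 140 * (M * M)" by linarith
  from for_bound[OF this assms(3) 1(1) assms(5)]
  have "6 + \<rho> 9 * ((9 + time p_cost_row \<rho>) + 8) \<le> 154 * (N * (M * M))" by simp
  moreover have "time p_cost \<rho> = 4 + (6 + \<rho> 9 * ((9 + time p_cost_row \<rho>) + 8))"
    by (simp add: p_cost_def algebra_simps)
  ultimately show ?thesis using 1 by linarith
qed

lemma time_p_dp:
  assumes "\<rho> 0 \<le> M" "\<rho> 1 \<le> M" "\<rho> 8 \<le> N" "\<rho> 9 \<le> N" "1 \<le> M" "1 \<le> N"
  shows "time p_dp \<rho> \<le> 500 * (N * (N * M))"
proof -
  have "time p_cell \<rho> \<le> 26 + time p_relax_students \<rho> + time p_relax_questions \<rho>"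
    by (simp add: p_cell_def)
  then have "time p_cell \<rho> \<le> 330 * M"
    using time_p_relax_students[of \<rho> M] time_p_relax_questions[of \<rho> M] assms by linarith
  from for_bound[OF this assms(4,5,6)]
  have "time p_dp_row \<rho> \<le> 344 * (N * M)" by (simp add: p_dp_row_def)
  moreover have 1: "1 \<le> N * M" "1 \<le> N * (N * M)" using assms by simp_all
  ultimately have "11 + time p_dp_row \<rho> \<le> 360 * (N * M)" by linarith
  from for_bound[OF this assms(3) 1(1) assms(6)]
  have "6 + \<rho> 8 * ((11 + time p_dp_row \<rho>) + 8) \<le> 374 * (N * (N * M))" by simp
  moreover have "time p_dp \<rho> = 4 + (6 + \<rho> 8 * ((11 + time p_dp_row \<rho>) + 8))"
    by (simp add: p_dp_def algebra_simps)
  ultimately show ?thesis using 1 by linarith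
qed

text \<open>For \<open>k \<ge> 2\<close> the base 2 is at most \<open>k\<close>; only
  \<open>k = 1\<close> needs the factor 16. The remaining \<open>2 * k + 1\<close>, the number of
  bits decoded per mask, is at most \<open>3 * k ^ 4\<close>, and 48 is 16 times 3.\<close>

lemma window_bound:
  assumes "k > 0"
  shows "(2 ^ (2 * k)) * (2 ^ (2 * k)) * (2 * k + 1) \<le> (48 :: nat) * k ^ (4 * k + 4)"
proof -
  have "(2 :: nat) ^ (2 * k) * 2 ^ (2 * k) = 2 ^ (4 * k)" by (simp flip: power_add)
  also have "\<dots> \<le> 16 * k ^ (4 * k)"
  proof (cases "k = 1")
    case False
    then have "(2 :: nat) ^ (4 * k) \<le> k ^ (4 * k)" using assms by (intro power_mono) auto
    then show ?thesis by simp
  qed simp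
  finally have 1: "(2 :: nat) ^ (2 * k) * 2 ^ (2 * k) \<le> 16 * k ^ (4 * k)" .
  have "k ^ 1 \<le> k ^ 4" using assms by (intro power_increasing) auto
  then have 2: "2 * k + 1 \<le> 3 * k ^ 4" using assms by (simp del: power_Suc)
  have "(2 ^ (2 * k)) * (2 ^ (2 * k)) * (2 * k + 1) \<le> (16 * k ^ (4 * k)) * (3 * k ^ 4)"
    by (rule mult_le_mono[OF 1 2])
  then show ?thesis by (simp add: power_add)
qed

context run
begin

lemma time_stages:
  assumes "m + r \<ge> 1"
  shows "time_all stages (input_store m r E \<alpha> \<gamma> k) \<le> 1000000 * ((m + r) ^ 3 * k ^ (4 * k + 4))"
proof -
  define M where "M = m + r + 1"
  define V :: nat where "V = 2 ^ (2 * k)"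
  define K where "K = 2 * k + 1"
  \<comment> \<open>A common bound for all stages. The dynamic program has at most
    \<open>(M * V) * (M * V)\<close> cells with work proportional to \<open>M\<close> in each; the
    factor \<open>K\<close> covers bit decoding and the table of powers. The extra 1 in
    \<open>M\<close> allows for \<open>Suc m\<close> and \<open>Suc r\<close> prefix
    lengths.\<close>
  define L where "L = M * (M * (M * (V * (V * K))))"
  have ge: "1 \<le> M" "1 \<le> V" "1 \<le> K" by (simp_all add: M_def V_def K_def)
  then have "1 \<le> M * V" by simp
  have lims: "m \<le> M" "r \<le> M" "Suc m \<le> M" "Suc r \<le> M" "m + r \<le> M" by (simp_all add: M_def)
  have NX: "Suc m * V \<le> M * V" "Suc r * V \<le> M * V" using lims by (intro mult_le_mono1; simp)+
  have le: "a \<le> a * b" if "1 \<le> b" for a b :: nat using that by simp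
  have L1: "1 \<le> L" unfolding L_def using ge by simp
  have "K \<le> L" "M \<le> L" "M * M \<le> L" "M * (V * (K * M)) \<le> L" "(M * V) * (M * M) \<le> L"
      "(M * V) * ((M * V) * M) \<le> L"
  proof -
    have "L = K * (M * M * M * V * V)" "L = M * (M * M * V * V * K)" "L = (M * M) * (M * V * V * K)"
      "L = (M * (V * (K * M))) * (M * V)" "L = ((M * V) * (M * M)) * (V * K)"
      "L = ((M * V) * ((M * V) * M)) * K" unfolding L_def by (simp_all add: algebra_simps)
    then show "K \<le> L" "M \<le> L" "M * M \<le> L" "M * (V * (K * M)) \<le> L" "(M * V) * (M * M) \<le> L"
      "(M * V) * ((M * V) * M) \<le> L"
      using ge by (metis le one_le_mult_iff nat_1_eq_mult_iff mult_le_mono nat_mult_1)+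
  qed
  note Ls = this
  have t1: "time p_setup (reg \<sigma>0) \<le> 100 * L"
    using time_p_setup[of "reg \<sigma>0"] L1 by linarith
  have t2: "time p_powers (reg \<sigma>1) \<le> 100 * L"
    using time_p_powers[of "reg \<sigma>1" K] reg1 ge Ls by (simp add: K_def)
  have t3: "time (p_build 0 6 0 6 7 ;; PAssign 8 (Reg 16)) (reg \<sigma>2) \<le> 500 * L"
    using time_p_build[of "reg \<sigma>2" K V 0 M 6 0 6 7 8] reg2 ge lims Ls(4)
    by (simp add: K_def V_def)
  have r3: "reg \<sigma>3 1 = r" "reg \<sigma>3 3 = K" "reg \<sigma>3 4 = V" "reg \<sigma>3 7 = Suc r"
    using reg2 frame3(1)[of 1] by (simp_all add: frame3(1) K_def V_def)
  have t4: "time (p_build 1 7 1 8 9 ;; PAssign 9 (Reg 16)) (reg \<sigma>3) \<le> 500 * L"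
    using time_p_build[of "reg \<sigma>3" K V 1 M 7 1 8 9 9] r3 ge lims Ls(4) by linarith
  have r4: "reg \<sigma>4 0 = m" "reg \<sigma>4 1 = r" "reg \<sigma>4 8 = Suc m * V" "reg \<sigma>4 9 = Suc r * V" "reg \<sigma>4 10 = m + r"
    using reg4 by (simp_all add: V_def)
  have t5: "time p_cost (reg \<sigma>4) \<le> 300 * L"
    using time_p_cost[of "reg \<sigma>4" M "M * V"] r4 ge lims NX \<open>1 \<le> M * V\<close> Ls(5) by linarith
  have t6: "time p_dp (reg \<sigma>5) \<le> 500 * L"
    using time_p_dp[of "reg \<sigma>5" M "M * V"] regs5[of 0] regs5[of 1] regs5[of 8] regs5[of 9]
      r4 ge lims NX \<open>1 \<le> M * V\<close> Ls(6) by simp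
  have t7: "time p_back (reg \<sigma>6) \<le> 100 * L"
    using time_p_back[of "reg \<sigma>6" M] regs6[of 10] r4 ge lims Ls(2) by simp
  have t8: "time p_out (reg \<sigma>7) \<le> 200 * L"
    using time_p_out[of "reg \<sigma>7" M] regs7[of 0] regs7[of 1] r4 ge lims Ls(3) by simp
  have "time_all stages (input_store m r E \<alpha> \<gamma> k) = time p_setup (reg \<sigma>0) + (time p_powers (reg \<sigma>1) +
     (time (p_build 0 6 0 6 7 ;; PAssign 8 (Reg 16)) (reg \<sigma>2) +
     (time (p_build 1 7 1 8 9 ;; PAssign 9 (Reg 16)) (reg \<sigma>3) + (time p_cost (reg \<sigma>4) +
     (time p_dp (reg \<sigma>5) + (time p_back (reg \<sigma>6) + (time p_out (reg \<sigma>7) + 1)))))))"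
    unfolding stages_def time_all.simps \<sigma>0_def \<sigma>1_def \<sigma>2_def \<sigma>3_def \<sigma>4_def \<sigma>5_def \<sigma>6_def \<sigma>7_def ..
  \<comment> \<open>The stage constants add up to 2300; the last unit is the closing
    \<open>Skip\<close>.\<close>
  also have "\<dots> \<le> 2301 * L" using t1 t2 t3 t4 t5 t6 t7 t8 L1 by linarith
  also have "L = M ^ 3 * (V * V * K)" by (simp add: L_def power3_eq_cube algebra_simps)
  also have "M ^ 3 * (V * V * K) \<le> (8 * (m + r) ^ 3) * (48 * k ^ (4 * k + 4))"
  proof (rule mult_le_mono)
    have "M ^ 3 \<le> (2 * (m + r)) ^ 3" using assms by (intro power_mono) (auto simp: M_def)
    also have "\<dots> = 8 * (m + r) ^ 3" by (simp only: power_mult_distrib) simp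
    finally show "M ^ 3 \<le> 8 * (m + r) ^ 3" .
    show "V * V * K \<le> 48 * k ^ (4 * k + 4)" unfolding V_def K_def by (rule window_bound[OF k])
  qed
  \<comment> \<open>The product of 2301, 8 and 48 is 883584, which is below the claimed
    constant.\<close>
  finally have "time_all stages (input_store m r E \<alpha> \<gamma> k) \<le>
      2301 * ((8 * (m + r) ^ 3) * (48 * k ^ (4 * k + 4)))" by simp
  then show ?thesis by simp
qed

end

theorem theorem5:
  "\<exists>(P :: com) (c :: nat). \<forall>(m :: nat) (r :: nat) (E :: (nat \<times> nat) set)
      (\<alpha> :: nat \<Rightarrow> nat) (\<gamma> :: nat \<Rightarrow> nat) (k :: nat).
     both_near_instance {..<m} {..<r} E \<alpha> \<gamma> k \<longrightarrow>
     (\<exists>t \<sigma>. exec P (input_store m r E \<alpha> \<gamma> k) t \<sigma> \<and>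
        both_near_solution {..<m} {..<r} E \<alpha> \<gamma> k (output_set m r \<sigma>) \<and>
        (m + r \<ge> 1 \<longrightarrow> t \<le> c * ((m + r) ^ 3 * k ^ (4 * k + 4))))"
proof (rule exI[of _ "compile_all stages"], rule exI[of _ 1000000], intro allI impI)
  fix m r :: nat and E :: "(nat \<times> nat) set" and \<alpha> \<gamma> :: "nat \<Rightarrow> nat" and k :: nat
  assume "both_near_instance {..<m} {..<r} E \<alpha> \<gamma> k"
  then interpret run m r k E \<alpha> \<gamma> by unfold_locales
  obtain t where "t \<le> time_all stages (input_store m r E \<alpha> \<gamma> k)"
    "exec (compile_all stages) (input_store m r E \<alpha> \<gamma> k) t \<sigma>8"
    using exec_ev_all[OF stages_ready] ev_all_stages by metis
  then show "\<exists>t \<sigma>. exec (compile_all stages) (input_store m r E \<alpha> \<gamma> k) t \<sigma> \<and>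
        both_near_solution {..<m} {..<r} E \<alpha> \<gamma> k (output_set m r \<sigma>) \<and>
        (m + r \<ge> 1 \<longrightarrow> t \<le> 1000000 * ((m + r) ^ 3 * k ^ (4 * k + 4)))"
    using correct time_stages le_trans by blast
qed

end
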